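(* Let $t \ge 3$ and $n \ge 1$ be integers, and let $I \subset [t]^n$ be an independent set of $K_t^n$ with $\epsilon := 1 - t\mu(I) < 1 - \frac{3}{t} + \frac{2}{t^2}$ (equivalently, $\mu(I) > \frac{3t-2}{t^3}$). Then there exists an independent set $J \subset [t]^n$ of $K_t^n$ of maximum size (so $\mu(J)=1/t$) such that \[ \mu(I \setminus J) \le 4\epsilon^{\eta(t)}, \qquad \text{where } \eta(t) = \frac{\log t}{\log t - \log(t-1)}. \]
   Context: $K_t^n$ is the graph with vertex set $[t]^n = \{1,\dots,t\}^n$ in which $x,y$ are adjacent iff $x_i \neq y_i$ for all $i \in [n]$. For $S \subseteq [t]^n$, $\mu(S) := |S|/t^n$. $\log$ is the natural logarithm. *)

theory Defs
  imports Complex_Main "HOL-Library.FuncSet"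
begin

text \<open>Points of \<open>[t]^n\<close> are functions on the index set \<open>{1..n}\<close>, extended by \<open>undefined\<close> outside it
  (\<open>PiE\<close>), so that \<open>[t]^n\<close> has exactly \<open>t ^ n\<close> elements.\<close>

definition cube :: "nat \<Rightarrow> nat \<Rightarrow> (nat \<Rightarrow> nat) set" where
  "cube t n = {1..n} \<rightarrow>\<^sub>E {1..t}"

definition K_adj :: "nat \<Rightarrow> nat \<Rightarrow> (nat \<Rightarrow> nat) \<Rightarrow> (nat \<Rightarrow> nat) \<Rightarrow> bool" where
  "K_adj t n x y \<longleftrightarrow> x \<in> cube t n \<and> y \<in> cube t n \<and> (\<forall>i\<in>{1..n}. x i \<noteq> y i)"

definition K_indep :: "nat \<Rightarrow> nat \<Rightarrow> (nat \<Rightarrow> nat) set \<Rightarrow> bool" where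
  "K_indep t n S \<longleftrightarrow> S \<subseteq> cube t n \<and> (\<forall>x\<in>S. \<forall>y\<in>S. \<not> K_adj t n x y)"

definition K_max_indep :: "nat \<Rightarrow> nat \<Rightarrow> (nat \<Rightarrow> nat) set \<Rightarrow> bool" where
  "K_max_indep t n J \<longleftrightarrow> K_indep t n J \<and> (\<forall>S. K_indep t n S \<longrightarrow> card S \<le> card J)"

definition mu :: "nat \<Rightarrow> nat \<Rightarrow> (nat \<Rightarrow> nat) set \<Rightarrow> real" where
  "mu t n S = real (card S) / real t ^ n"

definition eta :: "nat \<Rightarrow> real" where
  "eta t = ln (real t) / (ln (real t) - ln (real t - 1))"

end

theory Submission
  imports Defs "HOL-Analysis.Convex"
begin

text \<open>Write \<open>p = 1/t\<close>, \<open>q = 1 - p\<close>, so that \<open>q powr \<eta> = p\<close>, and let \<open>\<alpha>\<close> be the density of \<open>I\<close> inside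
  \<open>{x. x i = j}\<close>. The other slices of \<open>I\<close> in direction \<open>i\<close> are cross-independent to this one, so an
  isoperimetric inequality bounds each of their densities by \<open>(1 - \<alpha>) powr \<eta>\<close>. Since
  \<open>v - (t - 1) * v powr \<eta>\<close> is concave in \<open>v\<close> and equals \<open>1 - 3/t + 2/t^2\<close> at both \<open>q^2\<close> and \<open>q^3\<close>, the
  hypothesis leaves a gap: either \<open>\<alpha> < 1 - q^2\<close> or \<open>\<alpha> > 1 - q^3\<close>. In the second case the
  same bound gives the conclusion, with \<open>J = {x. x i = j}\<close>.

  It remains to see that some \<open>\<alpha>\<close> lies above the gap. The set \<open>I\<close> is deformed, without decreasing its
  measure, in steps so small that no \<open>\<alpha>\<close> can jump over the gap. Replacing coordinate values by \<open>1\<close>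
  makes the supports \<open>{i. x i = 1}\<close> an intersecting family, which is then extended to a maximal one.
  Shifts of a coordinate \<open>m\<close>, together with exchanges of a large minimal member by its
  complement, make the family independent of \<open>m\<close>. Inductively one is left with at most three
  coordinates, where the measure of a family without singletons is at most \<open>3p^2 - 2p^3\<close>.\<close>

section \<open>Constants and inequalities in one real variable\<close>

locale complete_graph_power =
  fixes t :: nat
  assumes t_ge_3: "3 \<le> t"
begin

definition p :: real where "p = 1 / real t"

definition q :: real where "q = 1 - p"

abbreviation \<eta> :: real where "\<eta> \<equiv> eta t"

lemma p_pos: "0 < p" and p_le: "p \<le> 1 / 3" and t_mult_p: "real t * p = 1"
  using t_ge_3 by (auto simp: p_def field_simps)

lemma q_ge: "2 / 3 \<le> q" and q_pos: "0 < q" and q_less_1: "q < 1" and p_plus_q: "p + q = 1"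
  using p_pos p_le by (auto simp: q_def)

text \<open>Yields \<open>p\<^sup>2 \<le> p * q\<^sup>2\<close>, and \<open>p * q\<^sup>2\<close> is
  the length of the gap from \<open>1 - q\<^sup>2\<close> to \<open>1 - q ^ 3\<close>: a change by
  at most \<open>p\<^sup>2\<close> cannot jump over it.\<close>

lemma p_le_q_square: "p \<le> q\<^sup>2"
  using p_le power_mono[OF q_ge, of 2] by (simp add: power2_eq_square)

lemma odds: "q / p = real t - 1"
  using t_ge_3 by (simp add: q_def p_def field_simps)

lemma ln_gap_pos: "0 < ln (real t) - ln (real t - 1)"
  using t_ge_3 by simp

lemma q_powr_eta: "q powr \<eta> = p"
proof -
  have q: "q = (real t - 1) / real t"
    using t_ge_3 by (simp add: q_def p_def field_simps)
  have "ln q = - (ln (real t) - ln (real t - 1))"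
    unfolding q using t_ge_3 by (subst ln_div) auto
  moreover have "\<eta> * (ln (real t) - ln (real t - 1)) = ln (real t)"
    using ln_gap_pos by (simp add: eta_def)
  ultimately have "\<eta> * ln q = - ln (real t)"
    by (metis mult_minus_right)
  then have "q powr \<eta> = exp (- ln (real t))"
    using q_pos by (simp add: powr_def)
  then show ?thesis
    using t_ge_3 by (simp add: exp_minus p_def field_simps)
qed

lemma q_power_powr_eta: "(q ^ k) powr \<eta> = p ^ k"
  using q_pos by (induction k) (auto simp: powr_mult q_powr_eta)

lemma eta_gt_1: "1 < \<eta>"
  using t_ge_3 ln_gap_pos by (simp add: eta_def field_simps)

lemma eta_le: "\<eta> \<le> real t * ln (real t)"
proof -
  have "ln (1 - p) \<le> - p"
    using ln_add_one_self_le_self2[of "- p"] p_le by simp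
  moreover have "ln (1 - p) = ln (real t - 1) - ln (real t)"
  proof -
    have "1 - p = (real t - 1) / real t"
      using t_ge_3 by (simp add: p_def field_simps)
    then show ?thesis
      using t_ge_3 by (simp add: ln_div)
  qed
  ultimately have g: "p \<le> ln (real t) - ln (real t - 1)"
    by simp
  have "ln (real t) / (ln (real t) - ln (real t - 1)) \<le> ln (real t) / p"
    using g p_pos t_ge_3 by (intro divide_left_mono) auto
  also have "\<dots> = real t * ln (real t)"
    by (simp add: p_def)
  finally show ?thesis
    by (simp add: eta_def)
qed

text \<open>Convexity, with the weight \<open>s\<close> exposed so that one \<open>s\<close> both
  expresses \<open>v\<close> and bounds \<open>v powr \<eta>\<close>. The endpoints used later are
  powers of \<open>q\<close>, where \<open>powr \<eta>\<close> gives powers of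
  \<open>p\<close>.\<close>

lemma powr_eta_chord:
  assumes "0 < x" "x < y" "x \<le> v" "v \<le> y"
  obtains s where "0 \<le> s" "s \<le> 1" "v = (1 - s) * x + s * y"
    "v powr \<eta> \<le> (1 - s) * x powr \<eta> + s * y powr \<eta>"
proof -
  define s where "s = (v - x) / (y - x)"
  have s: "0 \<le> s" "s \<le> 1"
    using assms by (auto simp: s_def field_simps)
  have v: "v = (1 - s) * x + s * y"
  proof -
    have "s * (y - x) = v - x"
      using assms by (simp add: s_def)
    then show ?thesis
      by (simp add: algebra_simps)
  qed
  have "convex_on {0<..} (\<lambda>x. x powr \<eta>)"
    using eta_gt_1 by (intro powr_convex) simp
  then have "v powr \<eta> \<le> (1 - s) * x powr \<eta> + s * y powr \<eta>"
    using s assms v unfolding convex_on_def by (auto dest!: bspec[of _ _ x] bspec[of _ _ y] spec[of _ "1 - s"] spec[of _ s])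
  then show ?thesis
    using s v that by blast
qed

text \<open>At \<open>v = q ^ k\<close> the right side is \<open>q ^ k - q * p ^ (k - 1)\<close>,
  which for \<open>k = 2\<close> and for \<open>k = 3\<close> equals \<open>q * (q - p)\<close>
  because \<open>p + q = 1\<close>. Concavity keeps the values in between above this level.\<close>

lemma concave_level_gap:
  assumes v: "q ^ 3 \<le> v" "v \<le> q\<^sup>2"
  shows "q * (q - p) \<le> v - q / p * v powr \<eta>"
proof -
  obtain s where s: "v = (1 - s) * q ^ 3 + s * q\<^sup>2"
    "v powr \<eta> \<le> (1 - s) * (q ^ 3) powr \<eta> + s * (q\<^sup>2) powr \<eta>"
    using powr_eta_chord[of "q ^ 3" "q\<^sup>2" v] v q_pos q_less_1 power_strict_decreasing[of 2 3 q] by auto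
  have "q / p * v powr \<eta> \<le> q / p * ((1 - s) * p ^ 3 + s * p\<^sup>2)"
    using s(2) q_pos p_pos by (intro mult_left_mono) (auto simp: q_power_powr_eta)
  also have "\<dots> = q * ((1 - s) * p\<^sup>2 + s * p)"
    using p_pos by (simp add: field_simps power2_eq_square power3_eq_cube)
  also have "\<dots> = v - q * (q - p)"
    unfolding s(1) q_def by (simp add: algebra_simps power2_eq_square power3_eq_cube)
  finally show ?thesis
    by simp
qed

text \<open>Prevents a merge of two coordinate values from jumping over the gap: \<open>b\<close>
  and \<open>c\<close> will be the densities of the merged slices, \<open>b\<close> being the
  larger.\<close>

lemma sum_of_two_largest:
  assumes b: "0 \<le> c" "c \<le> b" "b \<le> 1 - q\<^sup>2" "c \<le> (1 - b) powr \<eta>"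
  shows "b + c \<le> 1 - q ^ 3"
proof -
  have "b + c \<le> 2 * p"
  proof (cases "b \<le> p")
    case False
    obtain s where s: "1 - b = (1 - s) * q\<^sup>2 + s * q"
      "(1 - b) powr \<eta> \<le> (1 - s) * (q\<^sup>2) powr \<eta> + s * q powr \<eta>"
      using powr_eta_chord[of "q\<^sup>2" q "1 - b"] False b q_pos q_less_1 p_plus_q
      by (auto simp: power2_eq_square)
    \<comment> \<open>The chord has slope 1, since \<open>p\<^sup>2 = 2 * p - 1 + q\<^sup>2\<close>
      and \<open>p = 2 * p - 1 + q\<close>; hence \<open>c \<le> 2 * p - b\<close>.\<close>
    have "(1 - s) * p\<^sup>2 + s * p = 2 * p - 1 + ((1 - s) * q\<^sup>2 + s * q)"
      unfolding q_def by (simp add: algebra_simps power2_eq_square)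
    then show ?thesis
      using s b by (simp add: q_power_powr_eta q_powr_eta)
  qed (use b in auto)
  \<comment> \<open>This product is \<open>1 - q ^ 3 - 2 * p\<close>, by
    \<open>1 - q ^ 3 = p * (1 + q + q\<^sup>2)\<close>.\<close>
  moreover have "0 \<le> p * (q\<^sup>2 + q - 1)"
    using p_pos q_ge power_mono[OF q_ge, of 2] by (intro mult_nonneg_nonneg) (auto simp: power2_eq_square)
  then have "2 * p \<le> 1 - q ^ 3"
    unfolding q_def by (simp add: algebra_simps power2_eq_square power3_eq_cube)
  ultimately show ?thesis
    by simp
qed

text \<open>The two sides agree at \<open>w = 0\<close> and \<open>w = 1\<close>, and the derivative of their difference
  changes sign at most once, from positive to negative.\<close>

lemma two_point_inequality_normalized:
  assumes w: "0 \<le> w" "w \<le> 1"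
  shows "p + q * w powr \<eta> \<le> (q + p * w) powr \<eta>"
proof (rule ccontr)
  define \<phi> where "\<phi> = (\<lambda>w. (q + p * w) powr \<eta> - q * w powr \<eta> - p)"
  define \<phi>' where "\<phi>' = (\<lambda>w. \<eta> * (p * (q + p * w) powr (\<eta> - 1) - q * w powr (\<eta> - 1)))"
  assume "\<not> ?thesis"
  then have neg: "\<phi> w < 0"
    by (simp add: \<phi>_def)
  have \<phi>0: "\<phi> 0 = 0" and \<phi>1: "\<phi> 1 = 0"
    using p_plus_q eta_gt_1 by (auto simp: \<phi>_def q_powr_eta add.commute)
  have w01: "0 < w" "w < 1"
    using neg w \<phi>0 \<phi>1 by (metis less_eq_real_def less_irrefl)+
  have cont: "continuous_on {a..b} \<phi>" if "0 \<le> a" for a b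
    unfolding \<phi>_def using that eta_gt_1 q_pos p_pos
    by (intro continuous_intros continuous_on_powr') (auto simp: add_nonneg_nonneg)
  have der: "(\<phi> has_real_derivative \<phi>' x) (at x)" if "0 < x" for x
    unfolding \<phi>_def \<phi>'_def using that q_pos p_pos
    by (auto intro!: derivative_eq_intros simp: add_pos_pos algebra_simps)
  \<comment> \<open>A negative value at \<open>w\<close>, between the zeros 0 and 1, forces a
    negative slope at some \<open>c < w\<close> and a positive slope at some
    \<open>d > w\<close>.\<close>
  obtain c where c: "0 < c" "c < w" "\<phi>' c < 0"
  proof -
    obtain l z where "0 < z" "z < w" "DERIV \<phi> z :> l" "\<phi> w - \<phi> 0 = (w - 0) * l"
      using MVT[OF w01(1) cont] der by (metis order_refl real_differentiable_def)
    with der[of z] neg \<phi>0 w01 that show ?thesis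
      by (metis DERIV_unique diff_zero mult_less_0_iff order_less_asym)
  qed
  obtain d where d: "w < d" "\<phi>' d > 0"
  proof -
    have "\<And>x. w < x \<Longrightarrow> x < 1 \<Longrightarrow> \<phi> differentiable (at x)"
      using der w01 real_differentiable_def by (meson order_less_trans)
    then obtain l z where z: "w < z" "z < 1" "DERIV \<phi> z :> l" "\<phi> 1 - \<phi> w = (1 - w) * l"
      using MVT[OF w01(2) cont] w by metis
    then have "l = \<phi>' z"
      using der[of z] w01 DERIV_unique by force
    moreover have "0 < (1 - w) * l"
      using z neg \<phi>1 by simp
    then have "0 < l"
      using w01 by (simp add: zero_less_mult_iff)
    ultimately show ?thesis
      using that z by simp
  qed
  \<comment> \<open>Division by \<open>x powr (\<eta> - 1)\<close> turns the sign condition into a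
    lower bound on a decreasing function of \<open>x\<close>, so positivity at \<open>d\<close>
    passes down to \<open>c\<close>.\<close>
  have sgn: "0 < \<phi>' x \<longleftrightarrow> q / p < (q / x + p) powr (\<eta> - 1)" if "0 < x" for x
  proof -
    have "q / x + p = (q + p * x) / x"
      using that by (simp add: field_simps)
    then have "(q / x + p) powr (\<eta> - 1) = (q + p * x) powr (\<eta> - 1) / x powr (\<eta> - 1)"
      using that q_pos p_pos by (simp add: powr_divide)
    moreover have "0 < \<phi>' x \<longleftrightarrow> q * x powr (\<eta> - 1) < p * (q + p * x) powr (\<eta> - 1)"
      using eta_gt_1 by (simp add: \<phi>'_def zero_less_mult_iff)
    moreover have "q / p < u / v \<longleftrightarrow> q * v < p * u" if "0 < v" for u v
      using that p_pos by (simp add: field_simps)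
    ultimately show ?thesis
      using that by simp
  qed
  have "(q / d + p) powr (\<eta> - 1) \<le> (q / c + p) powr (\<eta> - 1)"
    using c d w01 q_pos p_pos eta_gt_1
    by (intro powr_mono2 add_right_mono divide_left_mono) (auto intro: add_nonneg_nonneg)
  then have "0 < \<phi>' c"
    using sgn[of c] sgn[of d] c d w01 by auto
  with c show False
    by simp
qed

text \<open>Homogeneous form of the preceding inequality: scale by \<open>z\<close> and take
  \<open>w = (y / z) powr (1 / \<eta>)\<close>. In the isoperimetric induction \<open>z\<close> is
  the largest slice density and \<open>y\<close> the second largest, standing in for all the
  others.\<close>

lemma two_point_inequality:
  assumes "0 \<le> y" "y \<le> z"
  shows "(p * z + q * y) powr (1 / \<eta>) \<le> q * z powr (1 / \<eta>) + p * y powr (1 / \<eta>)"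
proof (cases "z = 0")
  case False
  define w where "w = (y / z) powr (1 / \<eta>)"
  have z: "0 < z"
    using assms False by simp
  have w: "0 \<le> w" "w \<le> 1"
    using assms z eta_gt_1 by (auto simp: w_def intro!: powr_le1)
  have "w powr \<eta> = y / z"
    using assms z eta_gt_1 by (simp add: w_def powr_powr)
  then have "(p + q * (y / z)) powr (1 / \<eta>) \<le> ((q + p * w) powr \<eta>) powr (1 / \<eta>)"
    using two_point_inequality_normalized[OF w] p_pos q_pos assms z eta_gt_1
    by (intro powr_mono2) auto
  also have "\<dots> = q + p * w"
    using eta_gt_1 q_pos p_pos w by (simp add: powr_powr add_nonneg_nonneg)
  finally have "z powr (1 / \<eta>) * (p + q * (y / z)) powr (1 / \<eta>) \<le> z powr (1 / \<eta>) * (q + p * w)"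
    by (simp add: mult_left_mono)
  moreover have "z powr (1 / \<eta>) * (p + q * (y / z)) powr (1 / \<eta>) = (p * z + q * y) powr (1 / \<eta>)"
    using z by (simp add: powr_mult[symmetric] algebra_simps)
  moreover have "z powr (1 / \<eta>) * w = y powr (1 / \<eta>)"
    using z assms by (simp add: w_def powr_mult[symmetric])
  ultimately show ?thesis
    by (simp add: distrib_left mult.left_commute mult.commute[of _ q])
qed (use assms in auto)

text \<open>Source of the constant 4. With \<open>y = p\<^sup>2 / q\<^sup>2\<close> one has
  \<open>- ln (1 - y) \<le> 1 / (t * (t - 2))\<close>. Multiplied by
  \<open>\<eta> \<le> t * ln t\<close> this gives at most \<open>ln t / (t - 2)\<close>, and
  \<open>t \<le> 4 ^ (t - 2)\<close> bounds that by \<open>ln 4\<close>.\<close>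

lemma stability_constant: "1 / 4 \<le> (1 - p\<^sup>2 / q\<^sup>2) powr \<eta>"
proof -
  define y where "y = 1 / (real t - 1)\<^sup>2"
  have pq: "p\<^sup>2 / q\<^sup>2 = y"
    using odds p_pos q_pos unfolding y_def by (metis divide_divide_eq_right div_by_1 mult_1 power_divide power_one times_divide_eq_left)
  have t: "0 < real t * (real t - 2)"
    using t_ge_3 by simp
  have "2\<^sup>2 \<le> (real t - 1)\<^sup>2"
    using t_ge_3 by (intro power_mono) auto
  then have y: "0 < y" "y < 1"
    by (auto simp: y_def divide_less_eq)
  have inv: "inverse (1 - y) = 1 + 1 / (real t * (real t - 2))"
  proof -
    have "inverse (1 - 1 / (u + 1)) = 1 + 1 / u" if "0 < u" for u :: real
      using that by (simp add: field_simps)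
    moreover have "y = 1 / (real t * (real t - 2) + 1)"
      by (simp add: y_def algebra_simps power2_eq_square)
    ultimately show ?thesis
      using t by simp
  qed
  have "- ln (1 - y) = ln (1 + 1 / (real t * (real t - 2)))"
    using y by (simp add: inv[symmetric] ln_inverse)
  also have "\<dots> \<le> 1 / (real t * (real t - 2))"
    using t by (intro ln_add_one_self_le_self) auto
  finally have ln_y: "- ln (1 - y) \<le> 1 / (real t * (real t - 2))" .
  have "t \<le> 4 ^ (t - 2)"
  proof -
    have pow: "m + 3 \<le> (4::nat) ^ (m + 1)" for m
      by (induction m) auto
    obtain m where "t = m + 3"
      using t_ge_3 by (metis le_add_diff_inverse2)
    then show ?thesis
      using pow[of m] by simp
  qed
  then have "real t \<le> 4 ^ (t - 2)"
    by (metis of_nat_le_iff of_nat_numeral of_nat_power)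
  then have "ln (real t) \<le> ln (4 ^ (t - 2))"
    using t_ge_3 by simp
  also have "\<dots> = (real t - 2) * ln 4"
    using t_ge_3 by (simp add: ln_realpow of_nat_diff)
  finally have ln_t: "ln (real t) \<le> (real t - 2) * ln 4" .
  have "\<eta> * - ln (1 - y) \<le> (real t * ln (real t)) * (1 / (real t * (real t - 2)))"
    using eta_le ln_y y eta_gt_1 t_ge_3 by (intro mult_mono) auto
  also have "\<dots> = ln (real t) / (real t - 2)"
    using t_ge_3 by simp
  also have "\<dots> \<le> ln 4"
    using ln_t t_ge_3 by (simp add: field_simps)
  finally have "- ln 4 \<le> \<eta> * ln (1 - y)"
    by simp
  then have "exp (- ln 4) \<le> exp (\<eta> * ln (1 - y))"
    by simp
  then show ?thesis
    using y by (simp add: pq powr_def exp_minus)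
qed

section \<open>Isoperimetry and the gap\<close>

abbreviation pts :: "'a set \<Rightarrow> ('a \<Rightarrow> nat) set" where
  "pts X \<equiv> X \<rightarrow>\<^sub>E {1..t}"

definition dens :: "'a set \<Rightarrow> ('a \<Rightarrow> nat) set \<Rightarrow> real" where
  "dens X S = real (card S) / real t ^ card X"

text \<open>Here \<open>X\<close> is meant as the index set without \<open>i\<close>: a slice lives
  in the smaller cube, so inductions on the index set apply to it.\<close>

definition slice :: "'a set \<Rightarrow> 'a \<Rightarrow> nat \<Rightarrow> ('a \<Rightarrow> nat) set \<Rightarrow> ('a \<Rightarrow> nat) set" where
  "slice X i j S = {x \<in> pts X. x(i := j) \<in> S}"

definition cross :: "'a set \<Rightarrow> ('a \<Rightarrow> nat) set \<Rightarrow> ('a \<Rightarrow> nat) set \<Rightarrow> bool" where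
  "cross X A B \<longleftrightarrow> A \<subseteq> pts X \<and> B \<subseteq> pts X \<and> (\<forall>x\<in>A. \<forall>y\<in>B. \<exists>i\<in>X. x i = y i)"

lemma finite_pts: "finite X \<Longrightarrow> finite (pts X)"
  by (auto intro: finite_PiE)

lemma slice_subset: "slice X i j S \<subseteq> pts X"
  by (auto simp: slice_def)

lemma dens_nonneg: "0 \<le> dens X S"
  by (simp add: dens_def)

lemma dens_mono: "finite X \<Longrightarrow> B \<subseteq> pts X \<Longrightarrow> A \<subseteq> B \<Longrightarrow> dens X A \<le> dens X B"
  unfolding dens_def using finite_subset[OF _ finite_pts]
  by (intro divide_right_mono of_nat_mono card_mono) auto

lemma dens_le_1:
  assumes "finite X" "S \<subseteq> pts X"
  shows "dens X S \<le> 1"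
proof -
  have "dens X S \<le> dens X (pts X)"
    using assms dens_mono by blast
  also have "\<dots> = 1"
    using assms t_ge_3 by (simp add: dens_def card_PiE)
  finally show ?thesis .
qed

lemma card_slice:
  assumes "i \<notin> X" "S \<subseteq> pts (insert i X)"
  shows "card (slice X i j S) = card {x \<in> S. x i = j}"
proof (rule bij_betw_same_card)
  have *: "restrict x X \<in> pts X \<and> (restrict x X)(i := x i) = x" if "x \<in> pts (insert i X)" for x
    using that assms(1) by (auto simp: PiE_iff extensional_def fun_eq_iff)
  show "bij_betw (\<lambda>x. x(i := j)) (slice X i j S) {x \<in> S. x i = j}"
  proof (rule bij_betw_byWitness[where f' = "\<lambda>x. restrict x X"])
    show "\<forall>x\<in>slice X i j S. restrict (x(i := j)) X = x"
      using assms(1) by (auto simp: slice_def PiE_iff extensional_def fun_eq_iff)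
    show "\<forall>x\<in>{x \<in> S. x i = j}. (restrict x X)(i := j) = x"
      using * assms(2) by auto
    show "(\<lambda>x. x(i := j)) ` slice X i j S \<subseteq> {x \<in> S. x i = j}"
      by (auto simp: slice_def)
    show "(\<lambda>x. restrict x X) ` {x \<in> S. x i = j} \<subseteq> slice X i j S"
    proof (rule image_subsetI)
      fix x assume "x \<in> {x \<in> S. x i = j}"
      then show "restrict x X \<in> slice X i j S"
        using *[of x] assms(2) by (auto simp: slice_def)
    qed
  qed
qed

lemma card_eq_sum_fibers:
  assumes "finite X" "i \<in> X" "S \<subseteq> pts X"
  shows "card S = (\<Sum>j\<in>{1..t}. card {x \<in> S. x i = j})"
proof -
  have fin: "finite S"
    using assms finite_pts finite_subset by blast
  have "S = (\<Union>j\<in>{1..t}. {x \<in> S. x i = j})"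
    using assms(2,3) by (auto simp: PiE_iff)
  moreover have "card (\<Union>j\<in>{1..t}. {x \<in> S. x i = j}) = (\<Sum>j\<in>{1..t}. card {x \<in> S. x i = j})"
    using fin by (intro card_UN_disjoint) auto
  ultimately show ?thesis
    by simp
qed

lemma dens_insert:
  assumes "finite X" "i \<notin> X" "S \<subseteq> pts (insert i X)"
  shows "dens (insert i X) S = p * (\<Sum>j\<in>{1..t}. dens X (slice X i j S))"
  using card_eq_sum_fibers[of "insert i X" i S] assms t_ge_3
  by (simp add: dens_def card_slice p_def sum_divide_distrib[symmetric])

lemma cross_slice:
  assumes "cross (insert i X) A B" "i \<notin> X" "j \<noteq> k"
  shows "cross X (slice X i j A) (slice X i k B)"
  unfolding cross_def
proof (intro conjI ballI)
  fix x y assume "x \<in> slice X i j A" "y \<in> slice X i k B"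
  then obtain l where "l \<in> insert i X" "(x(i := j)) l = (y(i := k)) l"
    using assms(1) unfolding cross_def slice_def by blast
  then show "\<exists>l\<in>X. x l = y l"
    using assms by (auto split: if_splits)
qed (rule slice_subset)+

lemma ex_maximal_value:
  fixes f :: "nat \<Rightarrow> real"
  assumes "finite A" "A \<noteq> {}"
  obtains a where "a \<in> A" "\<And>b. b \<in> A \<Longrightarrow> f b \<le> f a"
proof -
  have "Max (f ` A) \<in> f ` A"
    using assms by simp
  then obtain a where "a \<in> A" "f a = Max (f ` A)"
    by auto
  then show ?thesis
    using that assms by (metis Max_ge finite_imageI imageI)
qed

text \<open>Equality holds when \<open>B\<close> is a subcube \<open>{x. \<forall>i\<in>Y. x i = 1}\<close> and \<open>A\<close> the complement of its
  neighbourhood.\<close>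

lemma cross_isoperimetry:
  assumes "finite X" "cross X A B"
  shows "dens X A + dens X B powr (1 / \<eta>) \<le> 1"
  using assms
proof (induction X arbitrary: A B rule: finite_induct)
  case empty
  then have "A \<subseteq> {\<lambda>_. undefined}" "B \<subseteq> {\<lambda>_. undefined}" "A = {} \<or> B = {}"
    by (auto simp: cross_def)
  then have "(A = {} \<or> A = {\<lambda>_. undefined}) \<and> B = {} \<or> A = {} \<and> B = {\<lambda>_. undefined}"
    by blast
  then show ?case
    by (auto simp: dens_def)
next
  case (insert i X)
  define a b where "a = (\<lambda>k. dens X (slice X i k A))" and "b = (\<lambda>k. dens X (slice X i k B))"
  have IH: "a k + b l powr (1 / \<eta>) \<le> 1" if "k \<noteq> l" for k l
    unfolding a_def b_def using insert.IH cross_slice[OF insert.prems insert.hyps(2) that] .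
  have sub: "A \<subseteq> pts (insert i X)" "B \<subseteq> pts (insert i X)"
    using insert.prems by (auto simp: cross_def)
  obtain k where k: "k \<in> {1..t}" "\<And>j. j \<in> {1..t} \<Longrightarrow> b j \<le> b k"
    using ex_maximal_value[of "{1..t}" b] t_ge_3 by auto
  have "{1..t} - {k} \<noteq> {}"
  proof (cases "k = 1")
    case True
    then have "2 \<in> {1..t} - {k}"
      using t_ge_3 by simp
    then show ?thesis
      by blast
  next
    case False
    then have "1 \<in> {1..t} - {k}"
      using t_ge_3 by simp
    then show ?thesis
      by blast
  qed
  then obtain l where l: "l \<in> {1..t} - {k}" "\<And>j. j \<in> {1..t} - {k} \<Longrightarrow> b j \<le> b l"
    using ex_maximal_value[of "{1..t} - {k}" b] by auto
  have card_rest: "real (card ({1..t} - {k})) = real t - 1"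
    using k(1) by (simp add: of_nat_diff)
  have t_minus: "p * (real t - 1) = q"
    using t_mult_p by (simp add: q_def algebra_simps)
  have "(\<Sum>j\<in>{1..t}. b j) = b k + (\<Sum>j\<in>{1..t} - {k}. b j)"
    using k(1) by (simp add: sum.remove)
  also have "\<dots> \<le> b k + (real t - 1) * b l"
    using sum_bounded_above[of "{1..t} - {k}" b "b l"] l(2) card_rest by simp
  finally have "p * (\<Sum>j\<in>{1..t}. b j) \<le> p * (b k + (real t - 1) * b l)"
    using p_pos by simp
  also have "\<dots> = p * b k + q * b l"
    by (simp add: distrib_left flip: t_minus)
  finally have dB: "dens (insert i X) B \<le> p * b k + q * b l"
    using dens_insert[OF insert.hyps sub(2)] by (simp add: b_def)
  have "dens (insert i X) B powr (1 / \<eta>) \<le> (p * b k + q * b l) powr (1 / \<eta>)"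
    using dB eta_gt_1 dens_nonneg by (intro powr_mono2) auto
  also have "\<dots> \<le> q * b k powr (1 / \<eta>) + p * b l powr (1 / \<eta>)"
    using k l dens_nonneg by (intro two_point_inequality) (auto simp: b_def)
  finally have B: "dens (insert i X) B powr (1 / \<eta>) \<le> q * b k powr (1 / \<eta>) + p * b l powr (1 / \<eta>)" .
  \<comment> \<open>The pairing is crossed: the slice of \<open>A\<close> at \<open>k\<close> is set
    against the second largest slice of \<open>B\<close>, every other slice of \<open>A\<close>
    against the largest. The weights \<open>p\<close> and \<open>q\<close> then match those of the
    two-point inequality, and everything adds up to 1.\<close>
  have "(\<Sum>j\<in>{1..t}. a j) = a k + (\<Sum>j\<in>{1..t} - {k}. a j)"
    using k(1) by (simp add: sum.remove)
  also have "\<dots> \<le> (1 - b l powr (1 / \<eta>)) + (real t - 1) * (1 - b k powr (1 / \<eta>))"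
  proof (rule add_mono)
    show "a k \<le> 1 - b l powr (1 / \<eta>)"
      using IH[of k l] l(1) by auto
    show "(\<Sum>j\<in>{1..t} - {k}. a j) \<le> (real t - 1) * (1 - b k powr (1 / \<eta>))"
      using IH[of _ k] unfolding card_rest[symmetric]
      by (intro sum_bounded_above) (auto simp: le_diff_eq)
  qed
  finally have "p * (\<Sum>j\<in>{1..t}. a j)
      \<le> p * ((1 - b l powr (1 / \<eta>)) + (real t - 1) * (1 - b k powr (1 / \<eta>)))"
    using p_pos by simp
  also have "\<dots> = p * (1 - b l powr (1 / \<eta>)) + q * (1 - b k powr (1 / \<eta>))"
    by (simp add: distrib_left flip: t_minus)
  finally have "dens (insert i X) A \<le> p * (1 - b l powr (1 / \<eta>)) + q * (1 - b k powr (1 / \<eta>))"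
    using dens_insert[OF insert.hyps sub(1)] by (simp add: a_def)
  then show ?case
    using B p_plus_q by (simp add: right_diff_distrib)
qed

corollary cross_bound:
  assumes "finite X" "cross X A B"
  shows "dens X B \<le> (1 - dens X A) powr \<eta>"
proof -
  have "(dens X B powr (1 / \<eta>)) powr \<eta> \<le> (1 - dens X A) powr \<eta>"
    using cross_isoperimetry[OF assms] eta_gt_1 by (intro powr_mono2) auto
  then show ?thesis
    using eta_gt_1 dens_nonneg[of X B] by (simp add: powr_powr)
qed

section \<open>Coordinate densities of an independent set\<close>

definition indep :: "'a set \<Rightarrow> ('a \<Rightarrow> nat) set \<Rightarrow> bool" where
  "indep X S \<longleftrightarrow> cross X S S"

lemma indep_subset_pts: "indep X S \<Longrightarrow> S \<subseteq> pts X"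
  by (simp add: indep_def cross_def)

lemma indep_agree: "indep X S \<Longrightarrow> x \<in> S \<Longrightarrow> y \<in> S \<Longrightarrow> \<exists>i\<in>X. x i = y i"
  by (simp add: indep_def cross_def)

lemma indepI:
  "S \<subseteq> pts X \<Longrightarrow> (\<And>x y. x \<in> S \<Longrightarrow> y \<in> S \<Longrightarrow> \<exists>i\<in>X. x i = y i) \<Longrightarrow> indep X S"
  by (simp add: indep_def cross_def)

lemma indep_subset: "indep X S \<Longrightarrow> S' \<subseteq> S \<Longrightarrow> indep X S'"
  unfolding indep_def cross_def by (metis (no_types, lifting) order_trans subsetD)

lemma indep_finite: "finite X \<Longrightarrow> indep X S \<Longrightarrow> finite S"
  using indep_subset_pts finite_pts finite_subset by metis

text \<open>Normalised inside the subcube \<open>x i = j\<close>, so that for \<open>i\<close> in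
  \<open>X\<close> the values over all \<open>j\<close> add up to \<open>real t * dens X S\<close>.
  Counting points of \<open>S\<close> itself makes the effect of an injection on \<open>S\<close>
  easy to follow.\<close>

definition alpha :: "'a set \<Rightarrow> 'a \<Rightarrow> nat \<Rightarrow> ('a \<Rightarrow> nat) set \<Rightarrow> real" where
  "alpha X i j S = real (card {x \<in> S. x i = j}) / real t ^ (card X - 1)"

lemma alpha_eq_dens_slice:
  assumes "i \<in> X" "finite X" "S \<subseteq> pts X"
  shows "alpha X i j S = dens (X - {i}) (slice (X - {i}) i j S)"
  using card_slice[of i "X - {i}" S j] assms by (simp add: alpha_def dens_def insert_absorb)

lemma alpha_nonneg: "0 \<le> alpha X i j S"
  by (simp add: alpha_def)

lemma alpha_le_1:
  assumes "i \<in> X" "finite X" "S \<subseteq> pts X"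
  shows "alpha X i j S \<le> 1"
  using alpha_eq_dens_slice[OF assms] dens_le_1[OF _ slice_subset] assms(2) by (metis finite_Diff)

lemma sum_alpha:
  assumes "finite X" "i \<in> X" "S \<subseteq> pts X"
  shows "(\<Sum>j\<in>{1..t}. alpha X i j S) = real t * dens X S"
proof -
  have "card X = Suc (card X - 1)"
    using assms by (metis One_nat_def Suc_pred card_gt_0_iff empty_iff)
  then have "real t ^ card X = real t * real t ^ (card X - 1)"
    by (metis power_Suc)
  then show ?thesis
    using card_eq_sum_fibers[OF assms] t_ge_3
    by (simp add: alpha_def dens_def sum_divide_distrib[symmetric])
qed

lemma alpha_bound:
  assumes "finite X" "i \<in> X" "indep X S" "j \<noteq> k"
  shows "alpha X i k S \<le> (1 - alpha X i j S) powr \<eta>"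
proof -
  have S: "S \<subseteq> pts X"
    using assms(3) by (rule indep_subset_pts)
  have "cross (X - {i}) (slice (X - {i}) i j S) (slice (X - {i}) i k S)"
    using cross_slice[of i "X - {i}" S S j k] assms by (simp add: indep_def insert_absorb)
  then show ?thesis
    using cross_bound[of "X - {i}"] assms by (simp add: alpha_eq_dens_slice[OF assms(2,1) S])
qed

lemma sum_other_alpha:
  assumes "finite X" "i \<in> X" "indep X S" "j \<in> {1..t}"
  shows "real t * dens X S - alpha X i j S \<le> q / p * (1 - alpha X i j S) powr \<eta>"
proof -
  have S: "S \<subseteq> pts X"
    using assms(3) by (rule indep_subset_pts)
  have "real t * dens X S - alpha X i j S = (\<Sum>k\<in>{1..t} - {j}. alpha X i k S)"
    using sum_alpha[OF assms(1,2) S] assms(4) by (simp add: sum_diff1)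
  also have "\<dots> \<le> real (card ({1..t} - {j})) * (1 - alpha X i j S) powr \<eta>"
    using alpha_bound[OF assms(1-3)] by (intro sum_bounded_above) auto
  also have "real (card ({1..t} - {j})) = q / p"
    using assms(4) by (simp add: odds of_nat_diff)
  finally show ?thesis .
qed

text \<open>The bound \<open>(3 * t - 2) / t ^ 3\<close> on the density; equally
  \<open>3 * p\<^sup>2 * q + p ^ 3\<close>, the probability that at least two of three independent
  events of probability \<open>p\<close> occur.\<close>

definition threshold :: real where "threshold = 3 * p\<^sup>2 - 2 * p ^ 3"

lemma t_mult_threshold: "real t * threshold = 1 - q * (q - p)"
proof -
  have "real t * threshold = (real t * p) * (3 * p - 2 * p\<^sup>2)"
    by (simp add: threshold_def algebra_simps power2_eq_square power3_eq_cube)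
  also have "\<dots> = 1 - q * (q - p)"
    unfolding t_mult_p by (simp add: q_def algebra_simps power2_eq_square)
  finally show ?thesis .
qed

text \<open>Contrapositive of \<open>concave_level_gap\<close> at \<open>v = 1 - a\<close>. It
  speaks of a bare number because it serves both for slices of the cube and for links of set
  families.\<close>

lemma gap:
  assumes "a + q / p * (1 - a) powr \<eta> > real t * threshold"
  shows "a < 1 - q\<^sup>2 \<or> 1 - q ^ 3 < a"
  using assms concave_level_gap[of "1 - a"] by (force simp: t_mult_threshold)

lemma alpha_gap:
  assumes "finite X" "i \<in> X" "indep X S" "j \<in> {1..t}" "threshold < dens X S"
  shows "alpha X i j S < 1 - q\<^sup>2 \<or> 1 - q ^ 3 < alpha X i j S"
proof (rule gap)
  have "real t * threshold < real t * dens X S"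
    using assms t_ge_3 by simp
  then show "real t * threshold < alpha X i j S + q / p * (1 - alpha X i j S) powr \<eta>"
    using sum_other_alpha[OF assms(1-4)] by simp
qed

text \<open>Shows that coordinate subcubes are of maximum size. Either all slices have density at
  most \<open>p\<close>, or the largest leaves \<open>v \<le> q\<close> uncovered; then
  \<open>v powr \<eta> \<le> v * q powr (\<eta> - 1) = v * (p / q)\<close>, so the other slices
  together contribute at most \<open>v\<close>.\<close>

lemma indep_dens_le:
  assumes "finite X" "i \<in> X" "indep X S"
  shows "dens X S \<le> p"
proof -
  have S: "S \<subseteq> pts X"
    using assms(3) by (rule indep_subset_pts)
  obtain j where j: "j \<in> {1..t}" "\<And>k. k \<in> {1..t} \<Longrightarrow> alpha X i k S \<le> alpha X i j S"
    using ex_maximal_value[of "{1..t}" "\<lambda>k. alpha X i k S"] t_ge_3 by auto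
  define v where "v = 1 - alpha X i j S"
  have "real t * dens X S \<le> 1"
  proof (cases "alpha X i j S \<le> p")
    case True
    have "(\<Sum>k\<in>{1..t}. alpha X i k S) \<le> real (card {1..t}) * p"
      using True j by (intro sum_bounded_above) force
    then show ?thesis
      using sum_alpha[OF assms(1,2) S] t_mult_p by simp
  next
    case False
    have v: "0 \<le> v" "v \<le> q"
      using False alpha_le_1[OF assms(2,1) S] p_plus_q by (auto simp: v_def)
    have "v powr \<eta> = v * v powr (\<eta> - 1)"
      using v by (simp add: powr_mult_base)
    also have "\<dots> \<le> v * q powr (\<eta> - 1)"
      using v eta_gt_1 by (intro mult_left_mono powr_mono2) auto
    also have "\<dots> = v * (p / q)"
      using q_pos by (simp add: powr_diff q_powr_eta)
    finally have "q / p * v powr \<eta> \<le> q / p * (v * (p / q))"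
      using p_pos q_pos by (intro mult_left_mono) auto
    also have "\<dots> = v"
      using p_pos q_pos by simp
    finally show ?thesis
      using sum_other_alpha[OF assms j(1)] by (simp add: v_def)
  qed
  then show ?thesis
    using t_ge_3 by (simp add: p_def field_simps)
qed

section \<open>Compression\<close>

text \<open>The bound is the upper end of the gap; for an independent set of density above
  \<open>threshold\<close> it suffices, by \<open>alpha_gap\<close>, to reach the lower end
  \<open>1 - q\<^sup>2\<close>.\<close>

definition has_dictator :: "'a set \<Rightarrow> ('a \<Rightarrow> nat) set \<Rightarrow> bool" where
  "has_dictator X S \<longleftrightarrow> (\<exists>i\<in>X. \<exists>j\<in>{1..t}. 1 - q ^ 3 < alpha X i j S)"

text \<open>A point stays put when its target is already occupied, which makes the map injective on
  \<open>S\<close>.\<close>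

definition shift_value :: "'a \<Rightarrow> nat \<Rightarrow> ('a \<Rightarrow> nat) set \<Rightarrow> ('a \<Rightarrow> nat) \<Rightarrow> 'a \<Rightarrow> nat" where
  "shift_value i a S x = (if x i = a \<and> x(i := 1) \<notin> S then x(i := 1) else x)"

lemma inj_on_shift_value: "inj_on (shift_value i a S) S"
proof (rule inj_onI)
  fix x y assume xy: "x \<in> S" "y \<in> S" "shift_value i a S x = shift_value i a S y"
  show "x = y"
  proof (cases "(x i = a \<and> x(i := 1) \<notin> S) \<and> (y i = a \<and> y(i := 1) \<notin> S)")
    case True
    then have "x(i := 1) = y(i := 1)"
      using xy by (simp add: shift_value_def)
    then have "x(i := 1, i := a) = y(i := 1, i := a)"
      by simp
    then show ?thesis
      using True by (simp add: fun_upd_idem)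
  next
    case False
    then show ?thesis
      using xy unfolding shift_value_def by (metis (no_types))
  qed
qed

lemma shift_value_in_pts: "x \<in> pts X \<Longrightarrow> i \<in> X \<Longrightarrow> shift_value i a S x \<in> pts X"
  using t_ge_3 by (auto simp: shift_value_def PiE_iff extensional_def)

text \<open>Two moved points agree at \<open>i\<close>. If only \<open>x\<close> moves and
  \<open>y i\<close> is not 1, then \<open>x\<close> agrees away from \<open>i\<close> either with
  \<open>y\<close> or, when \<open>y i = a\<close>, with the member \<open>y(i := 1)\<close>; that
  agreement survives the move.\<close>

lemma indep_shift_value:
  assumes S: "indep X S" and i: "i \<in> X" and a: "a \<noteq> 1"
  shows "indep X (shift_value i a S ` S)"
proof -
  let ?f = "shift_value i a S"
  have agree: "\<exists>k\<in>X. x k = y k" if "x \<in> S" "y \<in> S" for x y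
    using indep_agree[OF S that] .
  have one_moved: "\<exists>k\<in>X. ?f x k = y k"
    if xy: "x \<in> S" "y \<in> S" and moved: "x i = a" "x(i := 1) \<notin> S" and fixed: "y i \<noteq> a \<or> y(i := 1) \<in> S" for x y
  proof (cases "y i = 1")
    case True
    then show ?thesis
      using moved i by (auto simp: shift_value_def)
  next
    case False
    have "\<exists>k\<in>X. k \<noteq> i \<and> x k = y k"
    proof (cases "y i = a")
      case True
      then obtain k where "k \<in> X" "x k = (y(i := 1)) k"
        using agree[of x "y(i := 1)"] xy fixed by blast
      then show ?thesis
        using moved a by (auto split: if_splits)
    next
      case False
      then show ?thesis
        using agree[of x y] xy moved by metis
    qed
    then show ?thesis
      using moved by (auto simp: shift_value_def)
  qed
  have "\<exists>k\<in>X. ?f x k = ?f y k" if "x \<in> S" "y \<in> S" for x y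
  proof -
    consider "x i = a \<and> x(i := 1) \<notin> S" "y i = a \<and> y(i := 1) \<notin> S"
      | "x i = a \<and> x(i := 1) \<notin> S" "\<not> (y i = a \<and> y(i := 1) \<notin> S)"
      | "\<not> (x i = a \<and> x(i := 1) \<notin> S)" "y i = a \<and> y(i := 1) \<notin> S"
      | "\<not> (x i = a \<and> x(i := 1) \<notin> S)" "\<not> (y i = a \<and> y(i := 1) \<notin> S)"
      by blast
    then show ?thesis
    proof cases
      case 1
      then show ?thesis
        using i by (auto simp: shift_value_def)
    next
      case 2
      then have "?f y = y"
        by (auto simp: shift_value_def)
      then show ?thesis
        using one_moved[of x y] 2 that by auto
    next
      case 3
      then have "?f x = x"
        by (auto simp: shift_value_def)
      then show ?thesis
        using one_moved[of y x] 3 that by (metis (no_types))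
    next
      case 4
      then have "?f x = x" "?f y = y"
        by (auto simp: shift_value_def)
      then show ?thesis
        using agree that by simp
    qed
  qed
  moreover have "?f ` S \<subseteq> pts X"
    using shift_value_in_pts[OF _ i] indep_subset_pts[OF S] by blast
  ultimately show ?thesis
    by (intro indepI) auto
qed

lemma dens_shift_value: "dens X (shift_value i a S ` S) = dens X S"
  by (simp add: dens_def card_image inj_on_shift_value)

lemma alpha_shift_value_other:
  assumes "k \<noteq> i"
  shows "alpha X k l (shift_value i a S ` S) = alpha X k l S"
proof -
  have "{x \<in> shift_value i a S ` S. x k = l} = shift_value i a S ` {x \<in> S. x k = l}"
    using assms by (auto simp: shift_value_def)
  then show ?thesis
    by (simp add: alpha_def card_image inj_on_subset[OF inj_on_shift_value])
qed

lemma alpha_shift_value_le: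
  assumes "finite S" "l \<noteq> 1"
  shows "alpha X i l (shift_value i a S ` S) \<le> alpha X i l S"
proof -
  have "{x \<in> shift_value i a S ` S. x i = l} \<subseteq> {x \<in> S. x i = l}"
    using assms by (auto simp: shift_value_def)
  then show ?thesis
    using assms unfolding alpha_def by (intro divide_right_mono of_nat_mono card_mono) auto
qed

lemma alpha_shift_value_one:
  assumes "finite S"
  shows "alpha X i 1 (shift_value i a S ` S) \<le> alpha X i 1 S + alpha X i a S"
proof -
  have "{x \<in> shift_value i a S ` S. x i = 1} \<subseteq> shift_value i a S ` ({x \<in> S. x i = 1} \<union> {x \<in> S. x i = a})"
    by (auto simp: shift_value_def)
  then have "card {x \<in> shift_value i a S ` S. x i = 1}
      \<le> card (shift_value i a S ` ({x \<in> S. x i = 1} \<union> {x \<in> S. x i = a}))"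
    using assms by (intro card_mono) auto
  also have "\<dots> \<le> card ({x \<in> S. x i = 1} \<union> {x \<in> S. x i = a})"
    using assms by (intro card_image_le) auto
  also have "\<dots> \<le> card {x \<in> S. x i = 1} + card {x \<in> S. x i = a}"
    by (rule card_Un_le)
  finally show ?thesis
    unfolding alpha_def add_divide_distrib[symmetric]
    by (intro divide_right_mono) (auto simp flip: of_nat_add)
qed

text \<open>Only the density at value 1 of coordinate \<open>i\<close> can grow, and at most to the
  sum of the two merged densities. Without a dictator both lie below \<open>1 - q\<^sup>2\<close>,
  and \<open>sum_of_two_largest\<close> keeps their sum at or below
  \<open>1 - q ^ 3\<close>.\<close>

lemma has_dictator_shift_valueD:
  assumes X: "finite X" and S: "indep X S" "threshold < dens X S" and i: "i \<in> X"
    and a: "a \<noteq> 1" "a \<in> {1..t}"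
    and dict: "has_dictator X (shift_value i a S ` S)"
  shows "has_dictator X S"
proof (rule ccontr)
  assume no: "\<not> has_dictator X S"
  have low: "alpha X k l S < 1 - q\<^sup>2" if "k \<in> X" "l \<in> {1..t}" for k l
    using alpha_gap[OF X that(1) S(1) that(2) S(2)] no that by (auto simp: has_dictator_def)
  have fin: "finite S"
    using S X indep_finite by blast
  obtain k l where kl: "k \<in> X" "l \<in> {1..t}" "1 - q ^ 3 < alpha X k l (shift_value i a S ` S)"
    using dict by (auto simp: has_dictator_def)
  have "\<not> 1 - q ^ 3 < alpha X k l S"
    using no kl by (auto simp: has_dictator_def)
  then have "k = i" "l = 1"
    using kl alpha_shift_value_other[of k i] alpha_shift_value_le[OF fin, of l X i a] by fastforce+
  then have "1 - q ^ 3 < alpha X i 1 S + alpha X i a S"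
    using kl alpha_shift_value_one[OF fin, of X i a] by simp
  moreover have "alpha X i 1 S + alpha X i a S \<le> 1 - q ^ 3"
  proof (cases "alpha X i 1 S \<le> alpha X i a S")
    case True
    then show ?thesis
      using sum_of_two_largest[OF alpha_nonneg True _ alpha_bound[OF X i S(1) a(1)]] low[OF i a(2)] by simp
  next
    case False
    then have "alpha X i a S \<le> alpha X i 1 S"
      by simp
    from sum_of_two_largest[OF alpha_nonneg this _ alpha_bound[OF X i S(1)]] low[OF i, of 1] a t_ge_3
    show ?thesis
      by simp
  qed
  ultimately show False
    by simp
qed

text \<open>Each shift that moves a point lowers the total of all coordinate values over
  \<open>S\<close>, so shifting terminates, and a dictator is carried back through every
  shift.\<close>

lemma has_dictator_by_compression:
  assumes X: "finite X" and S: "indep X S" "threshold < dens X S"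
    and compressed: "\<And>S'. indep X S' \<Longrightarrow> threshold < dens X S' \<Longrightarrow>
      (\<And>x i. x \<in> S' \<Longrightarrow> i \<in> X \<Longrightarrow> x(i := 1) \<in> S') \<Longrightarrow> has_dictator X S'"
  shows "has_dictator X S"
  using S
proof (induction "\<Sum>x\<in>S. \<Sum>i\<in>X. x i" arbitrary: S rule: less_induct)
  case less
  show ?case
  proof (cases "\<forall>x\<in>S. \<forall>i\<in>X. x(i := 1) \<in> S")
    case True
    then show ?thesis
      using compressed less.prems by blast
  next
    case False
    then obtain x i where x: "x \<in> S" "i \<in> X" "x(i := 1) \<notin> S"
      by blast
    have sub: "S \<subseteq> pts X"
      using less.prems indep_subset_pts by blast
    define a where "a = x i"
    have a: "a \<noteq> 1" "a \<in> {1..t}"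
      using x sub by (auto simp: a_def PiE_iff fun_upd_idem)
    let ?f = "shift_value i a S"
    have fin: "finite S"
      using sub X finite_pts finite_subset by blast
    have le: "(\<Sum>k\<in>X. ?f y k) \<le> (\<Sum>k\<in>X. y k)" for y
      using a by (intro sum_mono) (auto simp: shift_value_def)
    have "?f x = x(i := 1)"
      using x by (simp add: shift_value_def a_def)
    then have lt: "(\<Sum>k\<in>X. ?f x k) < (\<Sum>k\<in>X. x k)"
      using a x X by (intro sum_strict_mono_ex1) (auto simp: a_def)
    have "(\<Sum>y\<in>?f ` S. \<Sum>k\<in>X. y k) = (\<Sum>y\<in>S. \<Sum>k\<in>X. ?f y k)"
      by (simp add: sum.reindex inj_on_shift_value)
    also have "\<dots> < (\<Sum>y\<in>S. \<Sum>k\<in>X. y k)"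
      using fin x(1) le lt by (intro sum_strict_mono_ex1) auto
    finally have "has_dictator X (?f ` S)"
      using less.hyps indep_shift_value[OF less.prems(1) x(2) a(1)] dens_shift_value less.prems(2) by metis
    then show ?thesis
      using has_dictator_shift_valueD[OF X less.prems x(2) a] by blast
  qed
qed

text \<open>Reset to 1 every coordinate of \<open>x\<close> where \<open>x\<close> and
  \<open>y\<close> share a value other than 1. The result is still in \<open>S\<close>, so it agrees
  with \<open>y\<close> somewhere; at a reset coordinate this is impossible, and elsewhere the
  common value is 1.\<close>

lemma compressed_supports_meet:
  assumes X: "finite X" and S: "indep X S"
    and compressed: "\<And>x i. x \<in> S \<Longrightarrow> i \<in> X \<Longrightarrow> x(i := 1) \<in> S"
    and xy: "x \<in> S" "y \<in> S"
  shows "\<exists>i\<in>X. x i = 1 \<and> y i = 1"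
proof -
  have reset: "(\<lambda>i. if i \<in> Z then 1 else x i) \<in> S" if "finite Z" "Z \<subseteq> X" for Z
    using that
  proof (induction Z rule: finite_induct)
    case empty
    then show ?case
      using xy by simp
  next
    case (insert i Z)
    have "(\<lambda>k. if k \<in> insert i Z then 1 else x k) = (\<lambda>k. if k \<in> Z then 1 else x k)(i := 1)"
      by auto
    then show ?case
      using insert compressed by (metis insert_subset)
  qed
  define Z where "Z = {i \<in> X. x i = y i \<and> x i \<noteq> 1}"
  have "(\<lambda>i. if i \<in> Z then 1 else x i) \<in> S"
    using reset[of Z] X by (auto simp: Z_def)
  then obtain k where k: "k \<in> X" "(if k \<in> Z then 1 else x k) = y k"
    using indep_agree[OF S _ xy(2)] by fast
  then have "k \<notin> Z"
    by (auto simp: Z_def split: if_splits)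
  then show ?thesis
    using k by (auto simp: Z_def)
qed

text \<open>The points of \<open>S' - S\<close> are removed one at a time. Each removal changes a
  slice density by at most \<open>p ^ (card X - 1) \<le> p\<^sup>2\<close>, no more than the length
  of the gap, so the large slice cannot fall below it; three coordinates are needed for the exponent
  2.\<close>

lemma has_dictator_subset:
  assumes X: "finite X" "3 \<le> card X" and S: "indep X S" "threshold < dens X S"
    and S': "indep X S'" "S \<subseteq> S'" "has_dictator X S'"
  shows "has_dictator X S"
  using S S'(2)
proof (induction "card (S' - S)" arbitrary: S)
  case 0
  have "finite S'"
    using S' X indep_finite by blast
  then have "S = S'"
    using 0 by auto
  then show ?case
    using S' by simp
next
  case (Suc n)
  have fin: "finite S'"
    using S' X indep_finite by blast
  obtain z where z: "z \<in> S'" "z \<notin> S"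
    using Suc by (metis Diff_iff card.empty ex_in_conv nat.distinct(1))
  define U where "U = insert z S"
  have indU: "indep X U"
    using indep_subset[OF S'(1)] z Suc.prems by (simp add: U_def)
  have "dens X S \<le> dens X U"
    using indep_subset_pts[OF indU] X by (intro dens_mono) (auto simp: U_def)
  moreover have "card (S' - U) = n"
    using Suc.hyps(2) z fin by (simp add: U_def card_Diff_insert[of z S' S])
  ultimately have "has_dictator X U"
    using Suc z indU by (auto simp: U_def)
  then obtain i j where ij: "i \<in> X" "j \<in> {1..t}" "1 - q ^ 3 < alpha X i j U"
    by (auto simp: has_dictator_def)
  have "card {x \<in> U. x i = j} \<le> card (insert z {x \<in> S. x i = j})"
    using finite_subset[OF Suc.prems(3) fin] by (intro card_mono) (auto simp: U_def)
  also have "\<dots> \<le> card {x \<in> S. x i = j} + 1"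
    by (rule card_insert_le_m1[THEN order_trans]) auto
  finally have "alpha X i j U \<le> alpha X i j S + 1 / real t ^ (card X - 1)"
    unfolding alpha_def add_divide_distrib[symmetric]
    by (intro divide_right_mono) (auto simp flip: of_nat_Suc)
  also have "1 / real t ^ (card X - 1) = p ^ (card X - 1)"
    by (simp add: p_def power_divide)
  also have "p ^ (card X - 1) \<le> p\<^sup>2"
    using X p_pos p_le by (intro power_decreasing) auto
  also have "p\<^sup>2 \<le> p * q\<^sup>2"
    using p_le_q_square p_pos by (simp add: power2_eq_square)
  also have "p * q\<^sup>2 = (1 - q ^ 3) - (1 - q\<^sup>2)"
    by (simp add: q_def algebra_simps power2_eq_square power3_eq_cube)
  finally have "1 - q\<^sup>2 < alpha X i j S"
    using ij by simp
  then have "1 - q ^ 3 < alpha X i j S"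
    using alpha_gap[OF X(1) ij(1) Suc.prems(1) ij(2) Suc.prems(2)] by simp
  then show ?case
    using ij unfolding has_dictator_def by blast
qed

section \<open>Biased measure on set families\<close>

text \<open>The \<open>p\<close>-biased measure. A family is a predicate on all sets, so the same
  \<open>P\<close> can also be measured over a smaller ground set.\<close>

definition pm :: "'a set \<Rightarrow> ('a set \<Rightarrow> bool) \<Rightarrow> real" where
  "pm X P = (\<Sum>A\<in>Pow X. of_bool (P A) * (p ^ card A * q ^ card (X - A)))"

lemma pm_cong: "(\<And>A. A \<subseteq> X \<Longrightarrow> P A \<longleftrightarrow> Q A) \<Longrightarrow> pm X P = pm X Q"
  unfolding pm_def by (intro sum.cong) auto

lemma weight_nonneg: "0 \<le> p ^ m * q ^ n"
  using p_pos q_pos by simp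

lemma pm_mono: "(\<And>A. A \<subseteq> X \<Longrightarrow> P A \<Longrightarrow> Q A) \<Longrightarrow> pm X P \<le> pm X Q"
  unfolding pm_def using weight_nonneg by (intro sum_mono mult_right_mono) auto

lemma pm_nonneg: "0 \<le> pm X P"
  unfolding pm_def using weight_nonneg by (intro sum_nonneg) auto

lemma pm_empty: "pm {} P = of_bool (P {})"
  by (simp add: pm_def)

lemma pm_insert:
  assumes "finite X" "i \<notin> X"
  shows "pm (insert i X) P = p * pm X (\<lambda>A. P (insert i A)) + q * pm X P"
proof -
  let ?w = "\<lambda>A. of_bool (P A) * (p ^ card A * q ^ card (insert i X - A))"
  have inj: "inj_on (insert i) (Pow X)"
    using assms(2) by (intro inj_onI) (metis Diff_insert_absorb PowD subsetD)
  have with_i: "?w (insert i A) = p * (of_bool (P (insert i A)) * (p ^ card A * q ^ card (X - A)))"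
    if "A \<in> Pow X" for A
  proof -
    have "insert i X - insert i A = X - A" "i \<notin> A" "finite A"
      using that assms by (auto intro: finite_subset)
    then show ?thesis
      by simp
  qed
  have without_i: "?w A = q * (of_bool (P A) * (p ^ card A * q ^ card (X - A)))" if "A \<in> Pow X" for A
  proof -
    have "insert i X - A = insert i (X - A)" "i \<notin> X - A" "finite (X - A)"
      using that assms by auto
    then show ?thesis
      by simp
  qed
  have "pm (insert i X) P = sum ?w (Pow X) + sum ?w (insert i ` Pow X)"
    unfolding pm_def Pow_insert using assms by (intro sum.union_disjoint) auto
  also have "sum ?w (insert i ` Pow X) = (\<Sum>A\<in>Pow X. ?w (insert i A))"
    using inj by (simp add: sum.reindex)
  also have "\<dots> = p * pm X (\<lambda>A. P (insert i A))"
    unfolding pm_def sum_distrib_left by (intro sum.cong refl with_i)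
  also have "sum ?w (Pow X) = q * pm X P"
    unfolding pm_def sum_distrib_left by (intro sum.cong refl without_i)
  finally show ?thesis
    by simp
qed

lemma pm_remove:
  assumes "finite X" "i \<in> X"
  shows "pm X P = p * pm (X - {i}) (\<lambda>A. P (insert i A)) + q * pm (X - {i}) P"
  using pm_insert[of "X - {i}" i P] assms by (simp add: insert_absorb)

lemma pm_True: "finite X \<Longrightarrow> pm X (\<lambda>_. True) = 1"
  by (induction X rule: finite_induct) (auto simp: pm_empty pm_insert p_plus_q)

lemma pm_nonempty:
  assumes "finite X"
  shows "pm X (\<lambda>A. A \<noteq> {}) = 1 - q ^ card X"
  using assms
proof (induction X rule: finite_induct)
  case (insert i X)
  then show ?case
    by (simp add: pm_insert pm_True) (simp add: q_def algebra_simps)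
qed (simp add: pm_empty)

lemma pm_le_1: "finite X \<Longrightarrow> pm X P \<le> 1"
  using pm_mono[of X P "\<lambda>_. True"] by (simp add: pm_True)

lemma pm_disj_conj: "pm X (\<lambda>A. P A \<or> Q A) + pm X (\<lambda>A. P A \<and> Q A) = pm X P + pm X Q"
  unfolding pm_def sum.distrib[symmetric] by (intro sum.cong) auto

lemma pm_singleton:
  assumes "finite X" "C \<subseteq> X"
  shows "pm X (\<lambda>A. A = C) = p ^ card C * q ^ card (X - C)"
proof -
  have "pm X (\<lambda>A. A = C) = (\<Sum>A\<in>Pow X. if A = C then p ^ card A * q ^ card (X - A) else 0)"
    unfolding pm_def by (intro sum.cong) auto
  also have "\<dots> = p ^ card C * q ^ card (X - C)"
    using assms by (simp add: sum.delta)
  finally show ?thesis .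
qed

text \<open>A uniformly random coordinate equals 1 with probability \<open>p\<close>, so this
  carries biased families into the cube with their measure preserved.\<close>

definition pullback :: "'a set \<Rightarrow> ('a set \<Rightarrow> bool) \<Rightarrow> ('a \<Rightarrow> nat) set" where
  "pullback X P = {x \<in> pts X. P {i \<in> X. x i = 1}}"

lemma slice_pullback:
  assumes "i \<notin> X" "j \<in> {1..t}"
  shows "slice X i j (pullback (insert i X) P) = pullback X (if j = 1 then (\<lambda>A. P (insert i A)) else P)"
proof -
  have "{k \<in> insert i X. (x(i := j)) k = 1} = (if j = 1 then insert i {k \<in> X. x k = 1} else {k \<in> X. x k = 1})" for x
    using assms(1) by auto
  moreover have "x(i := j) \<in> pts (insert i X)" if "x \<in> pts X" for x
    using that assms(2) by (auto simp: PiE_iff extensional_def)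
  ultimately show ?thesis
    unfolding slice_def pullback_def by auto
qed

lemma dens_pullback: "finite X \<Longrightarrow> dens X (pullback X P) = pm X P"
proof (induction X arbitrary: P rule: finite_induct)
  case empty
  then show ?case
    by (simp add: dens_def pullback_def pm_empty)
next
  case (insert i X)
  have "{1..t} = insert 1 ({1..t} - {1})"
    using t_ge_3 by auto
  then have "(\<Sum>j\<in>{1..t}. dens X (slice X i j (pullback (insert i X) P)))
      = (\<Sum>j\<in>insert 1 ({1..t} - {1}). pm X (if j = 1 then (\<lambda>A. P (insert i A)) else P))"
    using insert by (intro sum.cong) (auto simp: slice_pullback)
  also have "\<dots> = pm X (\<lambda>A. P (insert i A)) + (\<Sum>j\<in>{1..t} - {1}. pm X (if j = 1 then (\<lambda>A. P (insert i A)) else P))"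
    by (subst sum.insert) auto
  also have "(\<Sum>j\<in>{1..t} - {1}. pm X (if j = 1 then (\<lambda>A. P (insert i A)) else P)) = (\<Sum>j\<in>{1..t} - {1}. pm X P)"
    by (intro sum.cong) auto
  also have "\<dots> = (real t - 1) * pm X P"
    using t_ge_3 by (simp add: of_nat_diff)
  finally have "dens (insert i X) (pullback (insert i X) P) = p * (pm X (\<lambda>A. P (insert i A)) + (real t - 1) * pm X P)"
    using insert dens_insert[of X i "pullback (insert i X) P"] by (auto simp: pullback_def)
  moreover have "p * (real t - 1) = q"
    using t_mult_p by (simp add: q_def algebra_simps)
  ultimately show ?case
    using insert by (simp add: pm_insert distrib_left flip: mult.assoc)
qed

text \<open>Points whose supports meet agree at a coordinate with value 1, so the isoperimetric
  inequality of the cube applies to the pullbacks.\<close>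

lemma pm_cross_bound:
  assumes "finite X" and "\<And>A B. A \<subseteq> X \<Longrightarrow> B \<subseteq> X \<Longrightarrow> P A \<Longrightarrow> Q B \<Longrightarrow> A \<inter> B \<noteq> {}"
  shows "pm X Q \<le> (1 - pm X P) powr \<eta>"
proof -
  have "cross X (pullback X P) (pullback X Q)"
    unfolding cross_def
  proof (intro conjI ballI)
    fix x y assume "x \<in> pullback X P" "y \<in> pullback X Q"
    then have "{i \<in> X. x i = 1} \<inter> {i \<in> X. y i = 1} \<noteq> {}"
      using assms(2)[of "{i \<in> X. x i = 1}" "{i \<in> X. y i = 1}"] by (simp add: pullback_def)
    then obtain i where "i \<in> X" "x i = 1" "y i = 1"
      by blast
    then show "\<exists>i\<in>X. x i = y i"
      by (intro bexI[of _ i]) auto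
  qed (auto simp: pullback_def)
  from cross_bound[OF assms(1) this] show ?thesis
    using assms(1) by (simp add: dens_pullback)
qed

section \<open>Monotone families and maximal intersecting families\<close>

definition upset :: "'a set \<Rightarrow> ('a set \<Rightarrow> bool) \<Rightarrow> bool" where
  "upset X P \<longleftrightarrow> (\<forall>A B. A \<subseteq> B \<longrightarrow> B \<subseteq> X \<longrightarrow> P A \<longrightarrow> P B)"

text \<open>Induction on the ground set: monotonicity makes both families at least as large when the
  new element is present, and the product of the two increments is nonnegative. Below it bounds the
  union of two links by \<open>b + c - b * c\<close>.\<close>

lemma harris_inequality:
  assumes "finite X" "upset X P" "upset X Q"
  shows "pm X P * pm X Q \<le> pm X (\<lambda>A. P A \<and> Q A)"
  using assms
proof (induction X arbitrary: P Q rule: finite_induct)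
  case empty
  then show ?case
    by (simp add: pm_empty)
next
  case (insert i X)
  define P1 Q1 where "P1 = (\<lambda>A. P (insert i A))" and "Q1 = (\<lambda>A. Q (insert i A))"
  have up: "upset X R" "upset X (\<lambda>A. R (insert i A))" "pm X R \<le> pm X (\<lambda>A. R (insert i A))"
    if "upset (insert i X) R" for R
  proof -
    show "upset X R"
      using that unfolding upset_def by blast
    show "upset X (\<lambda>A. R (insert i A))"
      using that unfolding upset_def by (meson insert_mono)
    show "pm X R \<le> pm X (\<lambda>A. R (insert i A))"
      using that unfolding upset_def by (intro pm_mono) (meson insert_mono subset_insertI)
  qed
  note upP = up[OF insert.prems(1), folded P1_def] and upQ = up[OF insert.prems(2), folded Q1_def]
  have IH: "pm X P1 * pm X Q1 \<le> pm X (\<lambda>A. P1 A \<and> Q1 A)" "pm X P * pm X Q \<le> pm X (\<lambda>A. P A \<and> Q A)"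
    using insert.IH upP upQ by blast+
  have "0 \<le> (pm X P1 - pm X P) * (pm X Q1 - pm X Q)"
    using upP upQ by simp
  then have "0 \<le> p * q * ((pm X P1 - pm X P) * (pm X Q1 - pm X Q))"
    using p_pos q_pos by simp
  also have "\<dots> = p * (pm X P1 * pm X Q1) + q * (pm X P * pm X Q)
      - (p * pm X P1 + q * pm X P) * (p * pm X Q1 + q * pm X Q)"
    by (simp add: q_def algebra_simps)
  finally have "(p * pm X P1 + q * pm X P) * (p * pm X Q1 + q * pm X Q)
      \<le> p * (pm X P1 * pm X Q1) + q * (pm X P * pm X Q)"
    by simp
  also have "\<dots> \<le> p * pm X (\<lambda>A. P1 A \<and> Q1 A) + q * pm X (\<lambda>A. P A \<and> Q A)"
    using IH p_pos q_pos by (intro add_mono mult_left_mono) auto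
  finally show ?case
    using insert.hyps by (simp add: pm_insert P1_def Q1_def)
qed

text \<open>The biased counterpart of the slice density at value 1; \<open>alpha_pullback\<close>
  identifies the two.\<close>

definition link :: "'a set \<Rightarrow> 'a \<Rightarrow> ('a set \<Rightarrow> bool) \<Rightarrow> real" where
  "link X i P = pm (X - {i}) (\<lambda>A. P (insert i A))"

text \<open>Maximality is encoded as containing a set of every complementary pair. The case
  \<open>A = B\<close> of the first clause excludes the empty set.\<close>

definition maximal_intersecting :: "'a set \<Rightarrow> ('a set \<Rightarrow> bool) \<Rightarrow> bool" where
  "maximal_intersecting X P \<longleftrightarrow>
    (\<forall>A B. A \<subseteq> X \<longrightarrow> B \<subseteq> X \<longrightarrow> P A \<longrightarrow> P B \<longrightarrow> A \<inter> B \<noteq> {}) \<and> (\<forall>A. A \<subseteq> X \<longrightarrow> P A \<or> P (X - A))"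

definition has_link :: "'a set \<Rightarrow> ('a set \<Rightarrow> bool) \<Rightarrow> bool" where
  "has_link X P \<longleftrightarrow> (\<exists>i\<in>X. 1 - q ^ 3 < link X i P)"

lemma intersectingD:
  "maximal_intersecting X P \<Longrightarrow> A \<subseteq> X \<Longrightarrow> B \<subseteq> X \<Longrightarrow> P A \<Longrightarrow> P B \<Longrightarrow> A \<inter> B \<noteq> {}"
  unfolding maximal_intersecting_def by blast

lemma maximal_intersecting_Compl:
  assumes "maximal_intersecting X P" "A \<subseteq> X"
  shows "P (X - A) \<longleftrightarrow> \<not> P A"
  using assms intersectingD[OF assms(1), of A "X - A"] unfolding maximal_intersecting_def by blast

text \<open>If \<open>B\<close> were missing, its complement would be a member disjoint from
  \<open>A\<close>.\<close>

lemma maximal_intersecting_upset: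
  assumes "maximal_intersecting X P"
  shows "upset X P"
  unfolding upset_def
proof (intro allI impI, rule ccontr)
  fix A B assume "A \<subseteq> B" "B \<subseteq> X" "P A" "\<not> P B"
  then show False
    using maximal_intersecting_Compl[OF assms, of B] intersectingD[OF assms, of A "X - B"] by blast
qed

lemma upsetD: "upset X P \<Longrightarrow> P A \<Longrightarrow> A \<subseteq> B \<Longrightarrow> B \<subseteq> X \<Longrightarrow> P B"
  unfolding upset_def by blast

text \<open>Members avoiding \<open>i\<close> cross-intersect the link of \<open>i\<close> within
  \<open>X - {i}\<close>, so they play the part of the other slices in
  \<open>alpha_gap\<close>.\<close>

lemma link_gap:
  assumes X: "finite X" "i \<in> X" and P: "maximal_intersecting X P" "threshold < pm X P"
  shows "link X i P < 1 - q\<^sup>2 \<or> 1 - q ^ 3 < link X i P"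
proof (rule gap)
  have "pm (X - {i}) P \<le> (1 - link X i P) powr \<eta>"
    unfolding link_def
  proof (rule pm_cross_bound)
    fix A B assume AB: "A \<subseteq> X - {i}" "B \<subseteq> X - {i}" "P (insert i A)" "P B"
    then have "insert i A \<inter> B \<noteq> {}"
      using X by (intro intersectingD[OF P(1)]) auto
    then show "A \<inter> B \<noteq> {}"
      using AB by auto
  qed (use X in auto)
  then have "link X i P + q / p * pm (X - {i}) P \<le> link X i P + q / p * (1 - link X i P) powr \<eta>"
    using p_pos q_pos by (intro add_left_mono mult_left_mono) auto
  moreover have "real t * pm X P = real t * p * (link X i P + q / p * pm (X - {i}) P)"
    unfolding pm_remove[OF X, of P] link_def using p_pos by (simp add: field_simps)
  moreover have "real t * threshold < real t * pm X P"
    using P t_ge_3 by simp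
  ultimately show "real t * threshold < link X i P + q / p * (1 - link X i P) powr \<eta>"
    by (simp add: t_mult_p)
qed

lemma has_link_singleton:
  assumes "finite X" "i \<in> X" "maximal_intersecting X P" "P {i}"
  shows "has_link X P"
proof -
  have "link X i P = pm (X - {i}) (\<lambda>_. True)"
    unfolding link_def using assms
    by (intro pm_cong) (auto intro!: upsetD[OF maximal_intersecting_upset[OF assms(3)] assms(4)])
  then have "link X i P = 1"
    using assms by (simp add: pm_True)
  then show ?thesis
    using assms(2) q_pos unfolding has_link_def by (intro bexI[of _ i]) auto
qed

text \<open>Without singletons every member has at least two elements; on at most three points the
  family of all such sets has measure at most \<open>threshold\<close>.\<close>

lemma singleton_in_small:
  assumes X: "finite X" "card X \<le> 3" and P: "maximal_intersecting X P" "threshold < pm X P"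
  shows "\<exists>i\<in>X. P {i}"
proof (rule ccontr)
  assume no: "\<not> ?thesis"
  have "pm X P \<le> pm X (\<lambda>A. 2 \<le> card A)"
  proof (rule pm_mono)
    fix A assume A: "A \<subseteq> X" "P A"
    then have "A \<noteq> {}"
      using intersectingD[OF P(1), of A A] by auto
    moreover have "card A \<noteq> 1"
      using no A card_1_singletonE by (metis insert_subset)
    moreover have "finite A"
      using A X finite_subset by blast
    ultimately show "2 \<le> card A"
      by (metis One_nat_def Suc_1 Suc_leI card_0_eq le_neq_implies_less not_gr_zero)
  qed
  also have "\<dots> \<le> threshold"
  proof -
    consider "card X = 0" | "card X = 1" | "card X = 2" | "card X = 3"
      using X(2) by linarith
    then show ?thesis
    proof cases
      case 1
      then have "X = {}"
        using X by simp
      then show ?thesis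
        using p_pos p_le by (simp add: pm_empty threshold_def power2_eq_square power3_eq_cube)
    next
      case 2
      then obtain a where "X = {a}"
        using card_1_singletonE by blast
      then show ?thesis
        using p_pos p_le by (simp add: pm_empty pm_insert threshold_def power2_eq_square power3_eq_cube)
    next
      case 3
      then obtain a b where "X = {a, b}" "a \<noteq> b"
        by (auto simp: card_2_iff)
      then show ?thesis
        using p_pos p_le by (simp add: pm_empty pm_insert threshold_def power2_eq_square power3_eq_cube)
    next
      case 4
      then obtain a b c where "X = {a, b, c}" "a \<noteq> b" "b \<noteq> c" "a \<noteq> c"
        by (auto simp: card_3_iff)
      then show ?thesis
        using p_pos p_le by (simp add: pm_empty pm_insert threshold_def q_def algebra_simps power2_eq_square power3_eq_cube)
    qed
  qed
  finally show False
    using P(2) by simp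
qed

section \<open>Flips and shifts of maximal intersecting families\<close>

lemma link_add_le:
  assumes X: "finite X" "i \<in> X" and C: "C \<subseteq> X"
  shows "link X i (\<lambda>A. P A \<or> A = C) \<le> link X i P + (if i \<in> C then p ^ (card C - 1) * q ^ card (X - C) else 0)"
proof (cases "i \<in> C")
  case True
  have fin: "finite C"
    using C X finite_subset by blast
  have "link X i (\<lambda>A. P A \<or> A = C) \<le> pm (X - {i}) (\<lambda>A. P (insert i A) \<or> A = C - {i})"
    unfolding link_def by (intro pm_mono) auto
  also have "\<dots> \<le> link X i P + pm (X - {i}) (\<lambda>A. A = C - {i})"
    using pm_disj_conj[of "X - {i}" "\<lambda>A. P (insert i A)" "\<lambda>A. A = C - {i}"]
      pm_nonneg[of "X - {i}" "\<lambda>A. P (insert i A) \<and> A = C - {i}"] by (simp add: link_def)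
  also have "pm (X - {i}) (\<lambda>A. A = C - {i}) = p ^ card (C - {i}) * q ^ card (X - {i} - (C - {i}))"
    using X C by (intro pm_singleton) auto
  also have "X - {i} - (C - {i}) = X - C"
    using True by auto
  also have "card (C - {i}) = card C - 1"
    using True fin by simp
  finally show ?thesis
    using True by simp
next
  case False
  then have "link X i (\<lambda>A. P A \<or> A = C) = link X i P"
    unfolding link_def by (intro pm_cong) auto
  then show ?thesis
    using False by simp
qed

definition flip :: "'a set \<Rightarrow> 'a set \<Rightarrow> ('a set \<Rightarrow> bool) \<Rightarrow> 'a set \<Rightarrow> bool" where
  "flip X M P A \<longleftrightarrow> A \<noteq> M \<and> (P A \<or> A = X - M)"

context
  fixes X :: "'a set" and P :: "'a set \<Rightarrow> bool" and M :: "'a set"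
  assumes X: "finite X" and P: "maximal_intersecting X P"
    and M: "M \<subseteq> X" "P M" and minimal: "\<And>z. z \<in> M \<Longrightarrow> \<not> P (M - {z})"
begin

lemma proper_subset_of_minimal:
  assumes "B \<subseteq> M" "B \<noteq> M"
  shows "\<not> P B"
proof
  assume B: "P B"
  obtain z where "z \<in> M" "B \<subseteq> M - {z}"
    using assms by blast
  then have "P (M - {z})"
    using upsetD[OF maximal_intersecting_upset[OF P] B, of "M - {z}"] M by blast
  with minimal \<open>z \<in> M\<close> show False
    by blast
qed

lemma complement_of_minimal: "\<not> P (X - M)"
  using maximal_intersecting_Compl[OF P M(1)] M(2) by simp

lemma above_complement_of_minimal:
  assumes "X - M \<subseteq> D" "D \<subseteq> X" "D \<noteq> X - M"
  shows "P D"
proof -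
  have "X - D \<subseteq> M" "X - D \<noteq> M"
    using assms M by auto
  then have "\<not> P (X - D)"
    by (rule proper_subset_of_minimal)
  then show ?thesis
    using maximal_intersecting_Compl[OF P assms(2)] by blast
qed

text \<open>By minimality no remaining member lies inside \<open>M\<close>, so each meets
  \<open>X - M\<close>. For \<open>M = X\<close> the new member would be empty.\<close>

lemma maximal_intersecting_flip:
  assumes "M \<noteq> X"
  shows "maximal_intersecting X (flip X M P)"
proof -
  have disjoint_M: "A \<inter> (X - M) \<noteq> {}" if "A \<subseteq> X" "flip X M P A" for A
  proof (cases "A = X - M")
    case True
    then show ?thesis
      using assms M by auto
  next
    case False
    then have "P A" "A \<noteq> M"
      using that by (auto simp: flip_def)
    then have "\<not> A \<subseteq> M"
      using proper_subset_of_minimal by blast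
    then show ?thesis
      using that by blast
  qed
  have "A \<inter> B \<noteq> {}" if "A \<subseteq> X" "B \<subseteq> X" "flip X M P A" "flip X M P B" for A B
  proof (cases "A = X - M \<or> B = X - M")
    case True
    then show ?thesis
      using disjoint_M[of A] disjoint_M[of B] that by (auto simp: Int_commute)
  next
    case False
    then show ?thesis
      using that intersectingD[OF P] by (auto simp: flip_def)
  qed
  moreover have "flip X M P A \<or> flip X M P (X - A)" if A: "A \<subseteq> X" for A
  proof -
    have "X - (X - A) = A" "X - (X - M) = M"
      using A M by auto
    then show ?thesis
      using maximal_intersecting_Compl[OF P A] complement_of_minimal M unfolding flip_def by metis
  qed
  ultimately show ?thesis
    unfolding maximal_intersecting_def by blast
qed

text \<open>Since \<open>p \<le> q\<close>, the smaller of two complementary sets has the larger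
  weight.\<close>

lemma pm_flip_ge:
  assumes "card X \<le> 2 * card M"
  shows "pm X P \<le> pm X (flip X M P)"
proof -
  have fin: "finite M"
    using M X finite_subset by blast
  have M': "X - (X - M) = M"
    using M by auto
  have "pm X (flip X M P) + pm X (\<lambda>A. A = M) = pm X P + pm X (\<lambda>A. A = X - M)"
    unfolding pm_def sum.distrib[symmetric]
    using M complement_of_minimal by (intro sum.cong) (auto simp: flip_def)
  moreover have "pm X (\<lambda>A. A = M) \<le> pm X (\<lambda>A. A = X - M)"
  proof -
    define c where "c = card (X - M)"
    have c: "c \<le> card M"
      using assms M X fin by (simp add: c_def card_Diff_subset)
    then have "p ^ card M * q ^ c = (p * q) ^ c * p ^ (card M - c)"
      by (simp add: power_mult_distrib flip: power_add)
    also have "\<dots> \<le> (p * q) ^ c * q ^ (card M - c)"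
      using p_pos q_pos p_le q_ge by (intro mult_left_mono power_mono) auto
    also have "\<dots> = p ^ c * q ^ card M"
      using c by (simp add: power_mult_distrib flip: power_add)
    finally show ?thesis
      using X M by (simp add: pm_singleton M' c_def)
  qed
  ultimately show ?thesis
    by simp
qed

text \<open>The flip adds only \<open>C = X - M\<close>, which raises a link by at most
  \<open>p ^ (card C - 1) * q ^ card M\<close>. If \<open>C\<close> has at least two elements this
  is at most the gap length \<open>p * q\<^sup>2\<close>; a singleton \<open>C\<close> is treated
  directly.\<close>

lemma has_link_flipD:
  assumes card: "4 \<le> card X" "card X \<le> 2 * card M" and thr: "threshold < pm X P"
    and dict: "has_link X (flip X M P)"
  shows "has_link X P"
proof -
  define C where "C = X - M"
  have C: "C \<subseteq> X" "X - C = M"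
    using M by (auto simp: C_def)
  obtain i where i: "i \<in> X" "1 - q ^ 3 < link X i (flip X M P)"
    using dict by (auto simp: has_link_def)
  have "link X i (flip X M P) \<le> link X i (\<lambda>A. P A \<or> A = C)"
    unfolding link_def by (intro pm_mono) (auto simp: flip_def C_def)
  also have "\<dots> \<le> link X i P + (if i \<in> C then p ^ (card C - 1) * q ^ card M else 0)"
    using link_add_le[OF X i(1) C(1), of P] unfolding C(2) .
  finally have le: "1 - q ^ 3 < link X i P + (if i \<in> C then p ^ (card C - 1) * q ^ card M else 0)"
    using i by simp
  have gap_length: "p * q\<^sup>2 = (1 - q ^ 3) - (1 - q\<^sup>2)"
    by (simp add: q_def algebra_simps power2_eq_square power3_eq_cube)
  then have pos: "0 \<le> (1 - q ^ 3) - (1 - q\<^sup>2)"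
    using p_pos by (metis mult_nonneg_nonneg less_imp_le zero_le_power2)
  have "1 - q\<^sup>2 \<le> link X i P"
  proof (cases "i \<in> C")
    case False
    then show ?thesis
      using le pos by simp
  next
    case True
    have fin: "finite C"
      using C X finite_subset by blast
    then have "card C \<noteq> 0"
      using True by auto
    then consider "card C = 1" | "card C = 2" | "3 \<le> card C"
      by linarith
    then show ?thesis
    proof cases
      case 1
      \<comment> \<open>Here the increment \<open>q ^ card M\<close> may exceed the gap. Instead,
        every set properly containing \<open>C\<close> is already a member, so the link of
        \<open>i\<close> misses at most the empty set; four points make the missing weight at most
        \<open>q ^ 3\<close>.\<close>
      then have Ci: "C = {i}"
        using True card_1_singletonE by blast
      have "pm (X - {i}) (\<lambda>A. A \<noteq> {}) \<le> link X i P"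
        unfolding link_def
      proof (rule pm_mono)
        fix A assume "A \<subseteq> X - {i}" "A \<noteq> {}"
        then show "P (insert i A)"
          using Ci i by (intro above_complement_of_minimal) (auto simp: C_def)
      qed
      then have "1 - q ^ (card X - 1) \<le> link X i P"
        using X i by (simp add: pm_nonempty)
      moreover have "q ^ (card X - 1) \<le> q ^ 3"
        using card q_pos q_less_1 by (intro power_decreasing) auto
      ultimately show ?thesis
        using pos by linarith
    next
      case 2
      have "2 \<le> card M"
        using card by linarith
      then have "p ^ (card C - 1) * q ^ card M \<le> p * q\<^sup>2"
        using 2 p_pos q_pos q_less_1 by (simp add: power_decreasing)
      then show ?thesis
        using le True gap_length by simp
    next
      case 3
      have "p ^ (card C - 1) * q ^ card M \<le> p\<^sup>2 * 1"
        using 3 p_pos p_le q_pos q_less_1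
        by (intro mult_mono power_decreasing power_le_one) auto
      also have "\<dots> \<le> p * q\<^sup>2"
        using p_le_q_square p_pos by (simp add: power2_eq_square)
      finally show ?thesis
        using le True gap_length by simp
    qed
  qed
  then have "1 - q ^ 3 < link X i P"
    using link_gap[OF X i(1) P thr] by simp
  then show ?thesis
    using i by (auto simp: has_link_def)
qed

end

text \<open>The classical shift replacing \<open>m\<close> by \<open>i\<close>: of two sets that
  differ by this exchange as many are kept as before, with preference for the one containing
  \<open>i\<close>.\<close>

definition shift :: "'a \<Rightarrow> 'a \<Rightarrow> ('a set \<Rightarrow> bool) \<Rightarrow> 'a set \<Rightarrow> bool" where
  "shift m i P A \<longleftrightarrow>
    (if i \<in> A \<and> m \<notin> A then P A \<or> P (insert m (A - {i}))
     else if m \<in> A \<and> i \<notin> A then P A \<and> P (insert i (A - {m}))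
     else P A)"

text \<open>Let \<open>A\<close> be a new member disjoint from a member \<open>B\<close>. Exchanging
  \<open>i\<close> for \<open>m\<close> in \<open>A\<close> gives an old member, disjoint from
  \<open>B\<close> if \<open>m\<close> is not in \<open>B\<close>, and otherwise from the old member
  obtained by exchanging \<open>m\<close> for \<open>i\<close> in \<open>B\<close>.\<close>

lemma maximal_intersecting_shift:
  assumes P: "maximal_intersecting X P" and im: "i \<in> X" "m \<in> X" "i \<noteq> m"
  shows "maximal_intersecting X (shift m i P)"
proof -
  have moved: False
    if AB: "A \<subseteq> X" "B \<subseteq> X" "shift m i P A" "shift m i P B" "A \<inter> B = {}" and A: "\<not> P A" for A B
  proof -
    have A': "i \<in> A" "m \<notin> A" "P (insert m (A - {i}))"
      using AB A by (auto simp: shift_def split: if_splits)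
    have "i \<notin> B"
      using A' AB by blast
    show False
    proof (cases "m \<in> B")
      case True
      then have "P (insert i (B - {m}))"
        using AB \<open>i \<notin> B\<close> by (auto simp: shift_def)
      moreover have "insert m (A - {i}) \<inter> insert i (B - {m}) = {}"
        using AB im by blast
      ultimately show False
        using intersectingD[OF P _ _ A'(3)] AB im by (metis Diff_subset insert_subset order_trans)
    next
      case False
      then have "P B"
        using AB \<open>i \<notin> B\<close> by (auto simp: shift_def)
      moreover have "insert m (A - {i}) \<inter> B = {}"
        using AB False by blast
      ultimately show False
        using intersectingD[OF P _ _ A'(3)] AB im by (metis Diff_subset insert_subset order_trans)
    qed
  qed
  have "A \<inter> B \<noteq> {}" if "A \<subseteq> X" "B \<subseteq> X" "shift m i P A" "shift m i P B" for A B
    using moved[of A B] moved[of B A] intersectingD[OF P, of A B] that by (metis Int_commute)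
  moreover have "shift m i P A \<or> shift m i P (X - A)" if A: "A \<subseteq> X" for A
  proof -
    have c: "P (X - A) \<longleftrightarrow> \<not> P A" "P (X - insert m (A - {i})) \<longleftrightarrow> \<not> P (insert m (A - {i}))"
      "P (X - insert i (A - {m})) \<longleftrightarrow> \<not> P (insert i (A - {m}))"
      using A im by (auto intro!: maximal_intersecting_Compl[OF P])
    have "insert i (X - A - {m}) = X - insert m (A - {i})" if "i \<in> A" "m \<notin> A"
      using that im by auto
    moreover have "insert m (X - A - {i}) = X - insert i (A - {m})" if "m \<in> A" "i \<notin> A"
      using that im by auto
    ultimately show ?thesis
      using im c unfolding shift_def by auto
  qed
  ultimately show ?thesis
    unfolding maximal_intersecting_def by blast
qed

text \<open>On sets avoiding both elements, the links through exactly one of \<open>i\<close> and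
  \<open>m\<close> become their union and intersection. Inclusion-exclusion then preserves the
  measure.\<close>

lemma shift_blocks:
  assumes "i \<notin> A" "m \<notin> A" "i \<noteq> m"
  shows "shift m i P A \<longleftrightarrow> P A"
    and "shift m i P (insert i A) \<longleftrightarrow> P (insert i A) \<or> P (insert m A)"
    and "shift m i P (insert m A) \<longleftrightarrow> P (insert i A) \<and> P (insert m A)"
    and "shift m i P (insert i (insert m A)) \<longleftrightarrow> P (insert i (insert m A))"
  using assms by (auto simp: shift_def)

lemma pm_two_points:
  assumes "finite Y" "i \<notin> Y" "m \<notin> Y" "i \<noteq> m"
  shows "pm (insert i (insert m Y)) P = p * (p * pm Y (\<lambda>A. P (insert i (insert m A))) + q * pm Y (\<lambda>A. P (insert i A)))
     + q * (p * pm Y (\<lambda>A. P (insert m A)) + q * pm Y P)"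
  using assms by (simp add: pm_insert)

lemma pm_shift:
  assumes "finite X" "i \<in> X" "m \<in> X" "i \<noteq> m"
  shows "pm X (shift m i P) = pm X P"
proof -
  define Y where "Y = X - {i, m}"
  have Y: "X = insert i (insert m Y)" "finite Y" "i \<notin> Y" "m \<notin> Y"
    using assms by (auto simp: Y_def)
  have subset_Y: "i \<notin> A" "m \<notin> A" if "A \<subseteq> Y" for A
    using that Y by auto
  have "pm Y (\<lambda>A. shift m i P (insert i (insert m A))) = pm Y (\<lambda>A. P (insert i (insert m A)))"
    "pm Y (\<lambda>A. shift m i P (insert i A)) = pm Y (\<lambda>A. P (insert i A) \<or> P (insert m A))"
    "pm Y (\<lambda>A. shift m i P (insert m A)) = pm Y (\<lambda>A. P (insert i A) \<and> P (insert m A))"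
    "pm Y (shift m i P) = pm Y P"
    by (rule pm_cong, simp add: shift_blocks assms(4) subset_Y)+
  then show ?thesis
    using pm_disj_conj[of Y "\<lambda>A. P (insert i A)" "\<lambda>A. P (insert m A)"]
    unfolding Y(1) pm_two_points[OF Y(2-4) assms(4)] by (simp add: algebra_simps) (simp flip: distrib_left)
qed

lemma link_shift_other:
  assumes "finite X" "i \<in> X" "m \<in> X" "i \<noteq> m" "k \<in> X" "k \<noteq> i" "k \<noteq> m"
  shows "link X k (shift m i P) = link X k P"
proof -
  have "link X k (shift m i P) = pm (X - {k}) (shift m i (\<lambda>A. P (insert k A)))"
    unfolding link_def
  proof (rule pm_cong)
    fix A assume "A \<subseteq> X - {k}"
    have "insert m (insert k A - {i}) = insert k (insert m (A - {i}))"
      "insert i (insert k A - {m}) = insert k (insert i (A - {m}))"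
      using assms by auto
    then show "shift m i P (insert k A) \<longleftrightarrow> shift m i (\<lambda>A. P (insert k A)) A"
      using assms by (simp add: shift_def)
  qed
  also have "\<dots> = link X k P"
    unfolding link_def using assms by (intro pm_shift) auto
  finally show ?thesis .
qed

text \<open>Only the link of \<open>i\<close> can grow, from \<open>p * u + q * b\<close> to
  \<open>p * u + q * d\<close>. Harris gives \<open>d \<le> b + c - b * c\<close>, while
  \<open>b\<close> and \<open>c\<close> restrain each other because their families
  cross-intersect.\<close>

lemma has_link_shiftD:
  assumes X: "finite X" and P: "maximal_intersecting X P" "threshold < pm X P"
    and im: "i \<in> X" "m \<in> X" "i \<noteq> m" and dict: "has_link X (shift m i P)"
  shows "has_link X P"
proof (rule ccontr)
  assume no: "\<not> has_link X P"
  have low: "link X k P < 1 - q\<^sup>2" if "k \<in> X" for k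
    using link_gap[OF X that P] no that by (auto simp: has_link_def)
  define Y where "Y = X - {i, m}"
  have Y: "X = insert i (insert m Y)" "finite Y" "i \<notin> Y" "m \<notin> Y"
    using X im by (auto simp: Y_def)
  have subset_Y: "i \<notin> A" "m \<notin> A" if "A \<subseteq> Y" for A
    using that Y by auto
  have Xi: "X - {i} = insert m Y" and Xm: "X - {m} = insert i Y"
    using Y im by auto
  define u b c d where "u = pm Y (\<lambda>A. P (insert i (insert m A)))"
    and "b = pm Y (\<lambda>A. P (insert i A))" and "c = pm Y (\<lambda>A. P (insert m A))"
    and "d = pm Y (\<lambda>A. P (insert i A) \<or> P (insert m A))"
  have link_i: "link X i P = p * u + q * b" and link_m: "link X m P = p * u + q * c"
    unfolding link_def Xi Xm u_def b_def c_def using Y im by (auto simp: pm_insert insert_commute)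
  have shift_i: "link X i (shift m i P) = p * u + q * d"
  proof -
    have "pm Y (\<lambda>A. shift m i P (insert i (insert m A))) = u" "pm Y (\<lambda>A. shift m i P (insert i A)) = d"
      unfolding u_def d_def by (rule pm_cong, simp add: shift_blocks im(3) subset_Y)+
    then show ?thesis
      unfolding link_def Xi using Y im by (simp add: pm_insert)
  qed
  have shift_m: "link X m (shift m i P) \<le> link X m P"
    unfolding link_def using im by (intro pm_mono) (auto simp: shift_def split: if_splits)
  obtain k where k: "k \<in> X" "1 - q ^ 3 < link X k (shift m i P)"
    using dict by (auto simp: has_link_def)
  have "\<not> 1 - q ^ 3 < link X k P"
    using no k by (auto simp: has_link_def)
  then have "k = i"
    using k link_shift_other[OF X im k(1)] shift_m by fastforce
  then have big: "1 - q ^ 3 < p * u + q * d"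
    using k shift_i by simp
  have cross_bc: "A \<inter> B \<noteq> {}" if "A \<subseteq> Y" "B \<subseteq> Y" "P (insert i A)" "P (insert m B)" for A B
  proof -
    have "insert i A \<inter> insert m B \<noteq> {}"
      using that Y by (intro intersectingD[OF P(1)]) auto
    then show ?thesis
      using that Y im by auto
  qed
  have bc: "c \<le> (1 - b) powr \<eta>" "b \<le> (1 - c) powr \<eta>"
    unfolding b_def c_def using cross_bc by (auto intro!: pm_cross_bound Y(2)) (metis Int_commute)
  have up: "upset Y (\<lambda>A. P (insert k A))" if "k = i \<or> k = m" for k
    unfolding upset_def
  proof (intro allI impI)
    fix A B assume "A \<subseteq> B" "B \<subseteq> Y" "P (insert k A)"
    then show "P (insert k B)"
      using upsetD[OF maximal_intersecting_upset[OF P(1)], of "insert k A" "insert k B"] Y that by auto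
  qed
  have "b * c \<le> pm Y (\<lambda>A. P (insert i A) \<and> P (insert m A))"
    unfolding b_def c_def using up by (intro harris_inequality Y(2)) auto
  then have d: "d \<le> b + c - b * c"
    using pm_disj_conj[of Y "\<lambda>A. P (insert i A)" "\<lambda>A. P (insert m A)"] by (simp add: b_def c_def d_def)
  have u: "u \<le> 1" and pos: "0 \<le> b" "0 \<le> c" "b \<le> 1" "c \<le> 1"
    unfolding u_def b_def c_def using pm_le_1 pm_nonneg Y(2) by blast+
  \<comment> \<open>If \<open>x \<le> p\<close>, both densities are at most \<open>p\<close> and the
    bound is direct. If \<open>x > p\<close>, then \<open>y \<le> q powr \<eta> = p\<close>, so the
    increase \<open>q * y * (1 - x)\<close> is at most the gap length
    \<open>p * q\<^sup>2\<close>.\<close>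
  have key: "p * u + q * (x + y - x * y) \<le> 1 - q ^ 3"
    if xy: "y \<le> x" "0 \<le> y" "x \<le> 1" "y \<le> (1 - x) powr \<eta>" "p * u + q * x < 1 - q\<^sup>2" for x y
  proof (cases "x \<le> p")
    case True
    have "q * q \<le> (1 - x) * (1 - y)"
      using True xy p_plus_q q_pos by (intro mult_mono) auto
    then have "q * (x + y - x * y) \<le> q * (1 - q\<^sup>2)"
      using q_pos by (intro mult_left_mono) (auto simp: algebra_simps power2_eq_square)
    moreover have "p * u \<le> p"
      using u p_pos by simp
    ultimately have "p * u + q * (x + y - x * y) \<le> p + q * (1 - q\<^sup>2)"
      by simp
    also have "\<dots> = 1 - q ^ 3"
      by (simp add: q_def algebra_simps power2_eq_square power3_eq_cube)
    finally show ?thesis .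
  next
    case False
    have "y \<le> q powr \<eta>"
      using False xy p_plus_q eta_gt_1 by (intro order_trans[OF xy(4)] powr_mono2) auto
    then have "y * (1 - x) \<le> p * q"
      using False xy p_plus_q p_pos by (intro mult_mono) (auto simp: q_powr_eta)
    then have "q * (y * (1 - x)) \<le> q * (p * q)"
      using q_pos by simp
    then have "p * u + q * (x + y - x * y) \<le> 1 - q\<^sup>2 + q * (p * q)"
      using xy(5) by (simp add: algebra_simps)
    also have "\<dots> = 1 - q ^ 3"
      by (simp add: q_def algebra_simps power2_eq_square power3_eq_cube)
    finally show ?thesis .
  qed
  have "p * u + q * (b + c - b * c) \<le> 1 - q ^ 3"
  proof (cases "c \<le> b")
    case True
    then show ?thesis
      using key[of c b] pos bc low[OF im(1)] link_i by simp
  next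
    case False
    then show ?thesis
      using key[of b c] pos bc low[OF im(2)] link_m by (simp add: algebra_simps)
  qed
  moreover have "q * d \<le> q * (b + c - b * c)"
    using d q_pos by simp
  ultimately show False
    using big by simp
qed

text \<open>If neither a shift \<open>m \<rightarrow> i\<close> nor a flip of a large minimal member through \<open>m\<close> is available, then
  \<open>m\<close> is irrelevant: otherwise some \<open>insert m A\<close> and \<open>X - A\<close> would be minimal members meeting
  only in \<open>m\<close>, and one of them contains at least half of \<open>X\<close>.\<close>

lemma irrelevant_coordinate:
  assumes X: "finite X" "m \<in> X" and P: "maximal_intersecting X P"
    and no_shift: "\<And>i A. i \<in> X \<Longrightarrow> A \<subseteq> X \<Longrightarrow> m \<in> A \<Longrightarrow> i \<notin> A \<Longrightarrow> P A \<Longrightarrow> P (insert i (A - {m}))"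
    and no_flip: "\<And>M. M \<subseteq> X \<Longrightarrow> m \<in> M \<Longrightarrow> P M \<Longrightarrow> card X \<le> 2 * card M \<Longrightarrow> \<exists>z\<in>M. P (M - {z})"
    and A: "A \<subseteq> X - {m}" "P (insert m A)"
  shows "P A"
proof (rule ccontr)
  assume nA: "\<not> P A"
  define M N where "M = insert m A" and "N = X - A"
  have sub: "M \<subseteq> X" "N \<subseteq> X" "m \<in> M" "m \<in> N"
    using A X by (auto simp: M_def N_def)
  have MN: "P M" "P N"
    using A nA maximal_intersecting_Compl[OF P, of A] by (auto simp: M_def N_def)
  have "\<not> P (M - {z})" if z: "z \<in> M" for z
  proof
    assume Pz: "P (M - {z})"
    show False
    proof (cases "z = m")
      case True
      then have "M - {z} = A"
        using A by (auto simp: M_def)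
      then show False
        using Pz nA by simp
    next
      case False
      \<comment> \<open>\<open>M\<close> and \<open>N\<close> share only \<open>m\<close>;
        exchanging \<open>m\<close> for \<open>z\<close> in \<open>N\<close> produces a member
        disjoint from \<open>M - {z}\<close>.\<close>
      then have "P (insert z (N - {m}))"
        using z sub MN by (intro no_shift) (auto simp: M_def N_def)
      moreover have "(M - {z}) \<inter> insert z (N - {m}) = {}"
        by (auto simp: M_def N_def)
      ultimately show False
        using intersectingD[OF P _ _ Pz, of "insert z (N - {m})"] z sub by blast
    qed
  qed
  moreover have "\<not> P (N - {z})" if z: "z \<in> N" for z
  proof
    assume Pz: "P (N - {z})"
    show False
    proof (cases "z = m")
      case True
      then have "N - {z} = X - M"
        by (auto simp: M_def N_def)
      then show False
        using Pz MN maximal_intersecting_Compl[OF P sub(1)] by simp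
    next
      case False
      then have "P (insert z (M - {m}))"
        using z sub MN by (intro no_shift) (auto simp: M_def N_def)
      moreover have "(N - {z}) \<inter> insert z (M - {m}) = {}"
        by (auto simp: M_def N_def)
      ultimately show False
        using intersectingD[OF P _ _ Pz, of "insert z (M - {m})"] z sub by blast
    qed
  qed
  ultimately have "2 * card M < card X" "2 * card N < card X"
    using no_flip[of M] no_flip[of N] sub MN by (meson not_le)+
  moreover have "card X \<le> card M + card N"
  proof -
    have "M \<union> N = X"
      using sub by (auto simp: M_def N_def)
    then show ?thesis
      using card_Un_le[of M N] by simp
  qed
  ultimately show False
    by linarith
qed

text \<open>Outer induction on the size of the ground set, inner induction on the number of members
  containing a fixed \<open>m\<close>. A shift away from \<open>m\<close> and a flip of a member
  through \<open>m\<close> both lower that number; when neither is available, \<open>m\<close> is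
  irrelevant and can be deleted.\<close>

theorem maximal_intersecting_has_link:
  assumes "finite X" "maximal_intersecting X P" "threshold < pm X P"
  shows "has_link X P"
  using assms
proof (induction "card X" arbitrary: X P rule: less_induct)
  case (less X)
  note smaller = less.hyps
  have X: "finite X"
    by fact
  show ?case
  proof (cases "card X \<le> 3")
    case True
    then show ?thesis
      using singleton_in_small has_link_singleton less.prems by metis
  next
    case False
    then obtain m where m: "m \<in> X"
      by (metis all_not_in_conv card.empty zero_le)
    show ?thesis
      using less.prems
    proof (induction "card {A \<in> Pow X. m \<in> A \<and> P A}" arbitrary: P rule: less_induct)
      case (less P)
      note P = less.prems(2,3)
      have fin: "finite {A \<in> Pow X. m \<in> A \<and> P A}"
        using X by simp
      consider (shift) i A where "i \<in> X" "A \<subseteq> X" "m \<in> A" "i \<notin> A" "P A" "\<not> P (insert i (A - {m}))"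
        | (flip) M where "M \<subseteq> X" "m \<in> M" "P M" "card X \<le> 2 * card M" "\<And>z. z \<in> M \<Longrightarrow> \<not> P (M - {z})"
        | (irrelevant) "\<And>A. A \<subseteq> X - {m} \<Longrightarrow> P (insert m A) \<Longrightarrow> P A"
        using irrelevant_coordinate[OF X m P(1)] by metis
      then show ?case
      proof cases
        case shift
        then have im: "i \<in> X" "m \<in> X" "i \<noteq> m"
          using m by auto
        have "{A \<in> Pow X. m \<in> A \<and> shift m i P A} \<subset> {A \<in> Pow X. m \<in> A \<and> P A}"
          using shift by (auto simp: shift_def split: if_splits)
        then have "has_link X (shift m i P)"
          using less.hyps[OF psubset_card_mono[OF fin] X maximal_intersecting_shift[OF P(1) im]]
            P(2) pm_shift[OF X im] by simp
        then show ?thesis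
          using has_link_shiftD[OF X P im] by blast
      next
        case flip
        \<comment> \<open>A flip of \<open>X\<close> itself would insert the empty set. It cannot
          arise: for \<open>k\<close> other than \<open>m\<close>, one of \<open>X - {k}\<close> and
          \<open>X - {m}\<close> is a member, so \<open>X\<close> is not minimal.\<close>
        have "M \<noteq> X"
        proof
          assume "M = X"
          have "\<not> card X \<le> Suc 0"
            using False by simp
          then obtain k where k: "k \<in> X" "k \<noteq> m"
            using card_le_Suc0_iff_eq[OF X] m by metis
          then have "P {k} \<or> P (X - {k})"
            using maximal_intersecting_Compl[OF P(1), of "{k}"] by blast
          then have "P (X - {m}) \<or> P (X - {k})"
            using upsetD[OF maximal_intersecting_upset[OF P(1)], of "{k}" "X - {m}"] k by blast
          then show False
            using flip(5) \<open>M = X\<close> k m by blast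
        qed
        then have max: "maximal_intersecting X (flip X M P)"
          using maximal_intersecting_flip[OF X P(1) flip(1,3,5)] by blast
        have "flip X M P A \<longrightarrow> P A" if "m \<in> A" for A
          using that flip(2) by (auto simp: flip_def)
        then have "{A \<in> Pow X. m \<in> A \<and> flip X M P A} \<subset> {A \<in> Pow X. m \<in> A \<and> P A}"
          using flip by (auto simp: flip_def)
        then have "has_link X (flip X M P)"
          using less.hyps[OF psubset_card_mono[OF fin] X max] P(2)
            pm_flip_ge[OF X P(1) flip(1,3,5,4)] by simp
        then show ?thesis
          using has_link_flipD[OF X P(1) flip(1,3,5) _ flip(4) P(2)] False by simp
      next
        case irrelevant
        have iff: "P (insert m A) \<longleftrightarrow> P A" if "A \<subseteq> X - {m}" for A
          using irrelevant[OF that] upsetD[OF maximal_intersecting_upset[OF P(1)], of A "insert m A"] that m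
          by blast
        have "P A \<or> P (X - {m} - A)" if "A \<subseteq> X - {m}" for A
        proof -
          have "X - A = insert m (X - {m} - A)"
            using that m by auto
          then show ?thesis
            using iff[of "X - {m} - A"] maximal_intersecting_Compl[OF P(1), of A] that by auto
        qed
        moreover have "A \<inter> B \<noteq> {}" if "A \<subseteq> X - {m}" "B \<subseteq> X - {m}" "P A" "P B" for A B
          using intersectingD[OF P(1)] that by blast
        ultimately have "maximal_intersecting (X - {m}) P"
          unfolding maximal_intersecting_def by blast
        moreover have "pm X P = pm (X - {m}) P"
        proof -
          have "pm (X - {m}) (\<lambda>A. P (insert m A)) = pm (X - {m}) P"
            using iff by (intro pm_cong)
          then have "pm X P = (p + q) * pm (X - {m}) P"
            using pm_remove[OF X m, of P] by (simp add: distrib_right)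
          then show ?thesis
            by (simp add: p_plus_q)
        qed
        moreover have "card (X - {m}) < card X"
          using X m by (intro psubset_card_mono) auto
        ultimately have "has_link (X - {m}) P"
          using smaller[of "X - {m}" P] X P(2) by simp
        then obtain i where i: "i \<in> X - {m}" "1 - q ^ 3 < link (X - {m}) i P"
          by (auto simp: has_link_def)
        have "link X i P = link (X - {m}) i P"
        proof -
          have "pm (X - {i} - {m}) (\<lambda>A. P (insert i (insert m A))) = pm (X - {i} - {m}) (\<lambda>A. P (insert i A))"
          proof (rule pm_cong)
            fix A assume "A \<subseteq> X - {i} - {m}"
            then show "P (insert i (insert m A)) \<longleftrightarrow> P (insert i A)"
              using iff[of "insert i A"] i by (auto simp: insert_commute)
          qed
          then have "link X i P = (p + q) * pm (X - {i} - {m}) (\<lambda>A. P (insert i A))"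
            unfolding link_def using pm_remove[of "X - {i}" m "\<lambda>A. P (insert i A)"] X m i
            by (auto simp: distrib_right)
          then show ?thesis
            by (simp add: p_plus_q link_def Diff_insert2[symmetric] insert_commute)
        qed
        then show ?thesis
          using i unfolding has_link_def by (metis DiffD1)
      qed
    qed
  qed
qed

section \<open>Stability\<close>

text \<open>Take an inclusion-maximal intersecting family. If it contained neither \<open>A\<close>
  nor \<open>X - A\<close>, each would be blocked by a disjoint member, and these two blocking
  members would be disjoint from each other.\<close>

lemma extend_to_maximal_intersecting:
  assumes X: "finite X" "X \<noteq> {}" and F: "F \<subseteq> Pow X" "\<And>A B. A \<in> F \<Longrightarrow> B \<in> F \<Longrightarrow> A \<inter> B \<noteq> {}"
  obtains P where "maximal_intersecting X P" "\<And>A. A \<in> F \<Longrightarrow> P A"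
proof -
  define \<G> where "\<G> = {G. G \<subseteq> Pow X \<and> (\<forall>A\<in>G. \<forall>B\<in>G. A \<inter> B \<noteq> {})}"
  have "finite \<G>"
    using X by (intro finite_subset[of \<G> "Pow (Pow X)"]) (auto simp: \<G>_def)
  moreover have "F \<in> \<G>"
    using F by (auto simp: \<G>_def)
  ultimately obtain G where G: "G \<in> \<G>" "F \<subseteq> G" and max: "\<And>H. H \<in> \<G> \<Longrightarrow> G \<subseteq> H \<Longrightarrow> G = H"
    using finite_has_maximal2[of \<G> F] by metis
  have inter: "A \<inter> B \<noteq> {}" if "A \<in> G" "B \<in> G" for A B
    using G(1) that by (simp add: \<G>_def)
  have blocked: "\<exists>B\<in>G. A \<inter> B = {}" if A: "A \<subseteq> X" "A \<notin> G" "A \<noteq> {}" for A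
  proof (rule ccontr)
    assume no: "\<not> ?thesis"
    have "insert A G \<in> \<G>"
      unfolding \<G>_def
    proof (intro CollectI conjI ballI)
      show "insert A G \<subseteq> Pow X"
        using G A by (auto simp: \<G>_def)
      fix B C assume "B \<in> insert A G" "C \<in> insert A G"
      then show "B \<inter> C \<noteq> {}"
        using no A inter by (metis Int_commute Int_absorb insert_iff)
    qed
    then show False
      using max[of "insert A G"] A by blast
  qed
  have "A \<in> G \<or> X - A \<in> G" if A: "A \<subseteq> X" for A
  proof (rule ccontr)
    assume no: "\<not> ?thesis"
    \<comment> \<open>Blocking by a member is only available for nonempty sets, since an empty set
      is excluded by itself. Membership of \<open>X\<close> rules out this case.\<close>
    have nonempty: "A \<noteq> {} \<and> X - A \<noteq> {}"
    proof -
      have "X \<in> G"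
      proof (rule ccontr)
        assume "X \<notin> G"
        then obtain B where "B \<in> G" "X \<inter> B = {}"
          using blocked[of X] X by blast
        moreover have "B \<subseteq> X"
          using \<open>B \<in> G\<close> G(1) by (auto simp: \<G>_def)
        ultimately show False
          using inter[of B B] by blast
      qed
      then show ?thesis
        using no A by auto
    qed
    obtain B C where BC: "B \<in> G" "A \<inter> B = {}" "C \<in> G" "(X - A) \<inter> C = {}"
      using blocked[of A] blocked[of "X - A"] A no nonempty by blast
    moreover have "B \<subseteq> X"
      using \<open>B \<in> G\<close> G(1) by (auto simp: \<G>_def)
    ultimately show False
      using inter[of B C] by blast
  qed
  then have "maximal_intersecting X (\<lambda>A. A \<in> G)"
    unfolding maximal_intersecting_def using inter by blast
  then show ?thesis
    using that G(2) by blast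
qed

lemma alpha_pullback:
  assumes "finite X" "i \<in> X"
  shows "alpha X i 1 (pullback X P) = link X i P"
proof -
  have "slice (X - {i}) i 1 (pullback X P) = pullback (X - {i}) (\<lambda>A. P (insert i A))"
    using slice_pullback[of i "X - {i}" 1 P] assms t_ge_3 by (simp add: insert_absorb)
  moreover have "pullback X P \<subseteq> pts X"
    by (auto simp: pullback_def)
  ultimately show ?thesis
    using alpha_eq_dens_slice[OF assms(2,1), of "pullback X P" 1] assms
    by (simp add: dens_pullback link_def)
qed

lemma indep_pullback:
  assumes P: "maximal_intersecting X P"
  shows "indep X (pullback X P)"
proof (rule indepI)
  fix x y assume "x \<in> pullback X P" "y \<in> pullback X P"
  then have "{i \<in> X. x i = 1} \<inter> {i \<in> X. y i = 1} \<noteq> {}"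
    by (intro intersectingD[OF P]) (auto simp: pullback_def)
  then obtain i where "i \<in> X" "x i = 1" "y i = 1"
    by blast
  then show "\<exists>i\<in>X. x i = y i"
    by (intro bexI[of _ i]) auto
qed (auto simp: pullback_def)

text \<open>The supports extend to a maximal intersecting family whose pullback contains
  \<open>S\<close>. With more than three coordinates its large link comes down to \<open>S\<close>
  by \<open>has_dictator_subset\<close>; with at most three a member \<open>{i}\<close> forces
  \<open>x i = 1\<close> on all of \<open>S\<close>.\<close>

lemma compressed_has_dictator:
  assumes X: "finite X" "X \<noteq> {}" and S: "indep X S" "threshold < dens X S"
    and compressed: "\<And>x i. x \<in> S \<Longrightarrow> i \<in> X \<Longrightarrow> x(i := 1) \<in> S"
  shows "has_dictator X S"
proof -
  define supp where "supp = (\<lambda>x :: 'a \<Rightarrow> nat. {i \<in> X. x i = 1})"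
  have "supp x \<inter> supp y \<noteq> {}" if "x \<in> S" "y \<in> S" for x y
    using compressed_supports_meet[OF X(1) S(1) compressed that] by (auto simp: supp_def)
  then have "A \<inter> B \<noteq> {}" if "A \<in> supp ` S" "B \<in> supp ` S" for A B
    using that by blast
  moreover have "supp ` S \<subseteq> Pow X"
    by (auto simp: supp_def)
  ultimately obtain P where P: "maximal_intersecting X P" "\<And>x. x \<in> S \<Longrightarrow> P (supp x)"
    using extend_to_maximal_intersecting[OF X, of "supp ` S"] by (metis imageI)
  have sub: "S \<subseteq> pullback X P"
    using P(2) indep_subset_pts[OF S(1)] by (auto simp: pullback_def supp_def)
  have "dens X S \<le> dens X (pullback X P)"
    using sub X by (intro dens_mono) (auto simp: pullback_def)
  then have thr: "threshold < pm X P"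
    using S X by (simp add: dens_pullback)
  show ?thesis
  proof (cases "card X \<le> 3")
    case True
    then obtain i where i: "i \<in> X" "P {i}"
      using singleton_in_small[OF X(1) _ P(1) thr] by blast
    have one: "x i = 1" if "x \<in> S" for x
      using intersectingD[OF P(1), of "{i}" "supp x"] i P(2)[OF that] by (auto simp: supp_def)
    have zero: "alpha X i k S = 0" if "k \<noteq> 1" for k
    proof -
      have "{x \<in> S. x i = k} = {}"
        using one that by auto
      then show ?thesis
        by (simp only: alpha_def card.empty of_nat_0 div_0)
    qed
    have "(\<Sum>k\<in>{1..t}. alpha X i k S) = (\<Sum>k\<in>{1}. alpha X i k S)"
      using t_ge_3 zero by (intro sum.mono_neutral_right) auto
    then have "alpha X i 1 S = real t * dens X S"
      using sum_alpha[OF X(1) i(1) indep_subset_pts[OF S(1)]] by simp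
    also have "\<dots> > real t * threshold"
      using S t_ge_3 by simp
    finally have "1 - q * (q - p) < alpha X i 1 S"
      by (simp add: t_mult_threshold)
    moreover have "q * (q - p) \<le> q\<^sup>2"
      using p_pos q_pos by (simp add: power2_eq_square)
    ultimately have "1 - q ^ 3 < alpha X i 1 S"
      using alpha_gap[OF X(1) i(1) S(1) _ S(2), of 1] t_ge_3 by simp
    then show ?thesis
      unfolding has_dictator_def using i t_ge_3 by (intro bexI[of _ i] bexI[of _ 1]) auto
  next
    case False
    obtain i where "i \<in> X" "1 - q ^ 3 < link X i P"
      using maximal_intersecting_has_link[OF X(1) P(1) thr] by (auto simp: has_link_def)
    then have "has_dictator X (pullback X P)"
      unfolding has_dictator_def using t_ge_3 alpha_pullback[OF X(1)]
      by (intro bexI[of _ i] bexI[of _ 1]) auto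
    then show ?thesis
      using has_dictator_subset[OF X(1) _ S indep_pullback[OF P(1)] sub] False by simp
  qed
qed

lemma large_indep_has_dictator:
  assumes "finite X" "X \<noteq> {}" "indep X S" "threshold < dens X S"
  shows "has_dictator X S"
  using assms(1,3,4) by (rule has_dictator_by_compression) (rule compressed_has_dictator[OF assms(1,2)])

lemma dens_coordinate_subcube:
  assumes "finite X" "i \<in> X" "j \<in> {1..t}"
  shows "dens X {x \<in> pts X. x i = j} = p"
proof -
  have "x(i := j) \<in> pts X" if "x \<in> pts (X - {i})" for x
    using PiE_fun_upd[OF assms(3) that, of i] assms(2) by (simp add: insert_absorb)
  then have "slice (X - {i}) i j {x \<in> pts X. x i = j} = pts (X - {i})"
    unfolding slice_def by auto
  then have "card {x \<in> pts X. x i = j} = t ^ (card X - 1)"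
    using card_slice[of i "X - {i}" "{x \<in> pts X. x i = j}" j] assms
    by (simp add: insert_absorb card_PiE)
  moreover have "real t ^ card X = real t * real t ^ (card X - 1)"
    using assms by (metis card_gt_0_iff empty_iff power_minus_mult mult.commute)
  ultimately show ?thesis
    using t_ge_3 by (simp add: dens_def p_def)
qed

text \<open>From \<open>v \<le> q ^ 3\<close> follows
  \<open>v powr \<eta> \<le> v * (p ^ 3 / q ^ 3)\<close>, so the other slices make up at most the
  fraction \<open>p\<^sup>2 / q\<^sup>2\<close> of \<open>v\<close>. Thus \<open>v\<close> is
  linearly bounded by the deficit, and a second use of isoperimetry raises this to the power
  \<open>\<eta>\<close>.\<close>

lemma outside_dictator_bound:
  assumes X: "finite X" "i \<in> X" and S: "indep X S" and j: "j \<in> {1..t}" and big: "1 - q ^ 3 < alpha X i j S"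
  shows "dens X {x \<in> S. x i \<noteq> j} \<le> 4 * (1 - real t * dens X S) powr \<eta>"
proof -
  define v where "v = 1 - alpha X i j S"
  define \<epsilon> where "\<epsilon> = 1 - real t * dens X S"
  have v: "0 \<le> v" "v \<le> q ^ 3"
    using big alpha_le_1[OF X(2,1) indep_subset_pts[OF S]] by (auto simp: v_def)
  have rest: "real t * dens X S - alpha X i j S \<le> q / p * v powr \<eta>"
    using sum_other_alpha[OF X S j] by (simp add: v_def)
  have "v powr \<eta> = v * v powr (\<eta> - 1)"
    using v by (simp add: powr_mult_base)
  also have "\<dots> \<le> v * (q ^ 3) powr (\<eta> - 1)"
    using v eta_gt_1 by (intro mult_left_mono powr_mono2) auto
  also have "(q ^ 3) powr (\<eta> - 1) = p ^ 3 / q ^ 3"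
    using q_pos by (simp add: powr_diff q_power_powr_eta)
  finally have "q / p * v powr \<eta> \<le> q / p * (v * (p ^ 3 / q ^ 3))"
    using p_pos q_pos by (intro mult_left_mono) auto
  also have "\<dots> = v * (p\<^sup>2 / q\<^sup>2)"
    using p_pos q_pos by (simp add: field_simps power2_eq_square power3_eq_cube)
  finally have eps: "v * (1 - p\<^sup>2 / q\<^sup>2) \<le> \<epsilon>"
    using rest by (simp add: \<epsilon>_def v_def algebra_simps)
  have "p\<^sup>2 \<le> q\<^sup>2"
    using p_pos p_le q_ge by (intro power_mono) auto
  then have nonneg: "0 \<le> 1 - p\<^sup>2 / q\<^sup>2"
    using q_pos by simp
  have "card {x \<in> S. x i \<noteq> j} = card S - card {x \<in> S. x i = j}"
  proof -
    have "{x \<in> S. x i \<noteq> j} = S - {x \<in> S. x i = j}"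
      by auto
    then show ?thesis
      using indep_finite[OF X(1) S] by (simp add: card_Diff_subset)
  qed
  moreover have "card {x \<in> S. x i = j} \<le> card S"
    using indep_finite[OF X(1) S] by (intro card_mono) auto
  moreover have "real t ^ card X = real t * real t ^ (card X - 1)"
    using X by (metis card_gt_0_iff empty_iff power_minus_mult mult.commute)
  ultimately have "dens X {x \<in> S. x i \<noteq> j} = p * (real t * dens X S - alpha X i j S)"
    using t_ge_3 by (simp add: dens_def alpha_def p_def of_nat_diff field_simps)
  also have "\<dots> \<le> p * (q / p * v powr \<eta>)"
    using rest p_pos by (intro mult_left_mono) auto
  also have "\<dots> = q * v powr \<eta>"
    using p_pos by simp
  also have "\<dots> \<le> 1 * v powr \<eta>"
    using q_less_1 by (intro mult_right_mono) auto
  also have "\<dots> \<le> 4 * (1 - p\<^sup>2 / q\<^sup>2) powr \<eta> * v powr \<eta>"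
    using stability_constant by (intro mult_right_mono) auto
  also have "\<dots> = 4 * (v * (1 - p\<^sup>2 / q\<^sup>2)) powr \<eta>"
    by (simp add: powr_mult)
  also have "\<dots> \<le> 4 * \<epsilon> powr \<eta>"
    using eps v nonneg eta_gt_1 by (intro mult_left_mono powr_mono2) auto
  finally show ?thesis
    by (simp add: \<epsilon>_def)
qed

end

theorem theorem1p5:
  fixes t n :: nat and I :: "(nat \<Rightarrow> nat) set" and \<epsilon> :: real
  assumes "t \<ge> 3" and "n \<ge> 1"
    and "K_indep t n I"
    and "\<epsilon> = 1 - real t * mu t n I"
    and "\<epsilon> < 1 - 3 / real t + 2 / (real t)\<^sup>2"
  shows "\<exists>J. K_max_indep t n J \<and> mu t n J = 1 / real t
           \<and> mu t n (I - J) \<le> 4 * \<epsilon> powr eta t"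
proof -
  interpret complete_graph_power t
    using assms(1) by unfold_locales
  define X where "X = {1..n}"
  have X: "finite X" "X \<noteq> {}" "card X = n"
    using assms(2) by (auto simp: X_def)
  have mu_eq: "mu t n S = dens X S" for S
    by (simp add: mu_def dens_def X)
  have cube: "cube t n = pts X"
    by (simp add: cube_def X_def)
  have indep_iff: "K_indep t n S \<longleftrightarrow> indep X S" for S
    unfolding K_indep_def K_adj_def indep_def cross_def cube X_def[symmetric]
    by (metis (no_types, lifting) subsetD)
  have I: "indep X I"
    using assms(3) by (simp add: indep_iff)
  \<comment> \<open>This number is \<open>(1 - p) * (1 - 2 * p)\<close>, so the bound on the deficit
    says exactly that the density exceeds \<open>threshold\<close>.\<close>
  have "1 - 3 / real t + 2 / (real t)\<^sup>2 = q * (q - p)"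
    using assms(1) by (simp add: q_def p_def field_simps power2_eq_square)
  then have "real t * threshold < real t * dens X I"
    using assms(4,5) by (simp add: t_mult_threshold mu_eq)
  then have "threshold < dens X I"
    using assms(1) by simp
  then obtain i j where ij: "i \<in> X" "j \<in> {1..t}" "1 - q ^ 3 < alpha X i j I"
    using large_indep_has_dictator[OF X(1,2) I] unfolding has_dictator_def by blast
  define J where "J = {x \<in> pts X. x i = j}"
  have J: "indep X J" "dens X J = p"
    using ij dens_coordinate_subcube[OF X(1) ij(1,2)] by (auto simp: J_def intro!: indepI bexI[of _ i])
  have "card S \<le> card J" if "K_indep t n S" for S
  proof -
    have "dens X S \<le> dens X J"
      using indep_dens_le[OF X(1) ij(1)] that J(2) by (simp add: indep_iff)
    then show ?thesis
      using assms(1) by (simp add: dens_def divide_le_cancel)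
  qed
  then have "K_max_indep t n J"
    using J by (simp add: K_max_indep_def indep_iff)
  moreover have "I - J = {x \<in> I. x i \<noteq> j}"
    using indep_subset_pts[OF I] by (auto simp: J_def)
  then have "mu t n (I - J) \<le> 4 * \<epsilon> powr eta t"
    using outside_dictator_bound[OF X(1) ij(1) I ij(2,3)] by (simp add: mu_eq assms(4))
  ultimately show ?thesis
    using J(2) by (auto simp: mu_eq p_def)
qed

end
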